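(* Let $0<t_1<t_2$, $\rho=t_2/t_1$ and $c_\rho=2\log(2+\sqrt{\rho})$. Let $S$ be a standard Brownian motion, $S_n=S(t_n)$, and let $\psi_{nk}(x)=\frac{1}{\sqrt{k!}}H_{e_k}(x/\sqrt{t_n})$ for $n=1,2$ and $k\ge 0$, where $H_{e_k}$ are the Hermite polynomials. Suppose $Y=\sum_{k=0}^{K}a_k\psi_{2k}(S_2)$ for some real constants $a_0,\dots,a_K$, and let $\beta$, $\tilde\beta$ and $\mathsf{MSE}(\tilde\beta)=\mathsf{E}[|\tilde\beta-\beta|^2]$ be the regression coefficient vector, its estimator from $N$ independent replications, and its mean square error, as defined in the context. The supremum below is over all $(a_0,\dots,a_K)\in\mathbb{R}^{K+1}$ for which the resulting $\beta$ satisfies $|\beta|=1$. (i) If $K=K_N=\lfloor(1-\delta)\log N/c_\rho\rfloor$ for some $\delta\in(0,1)$, then $$\lim_{N\to\infty}\ \sup_{|\beta|=1}\mathsf{MSE}(\tilde\beta)=0.$$ (ii) If $K=K_N=\lfloor(1+\delta)\log N/c_\rho\rfloor$ for some $\delta>0$, then $$\lim_{N\to\infty}\ \sup_{|\beta|=1}\mathsf{MSE}(\tilde\beta)=\infty.$$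
   Context: $\log$ is the natural logarithm, $|\cdot|$ is the Euclidean norm on vectors. The Hermite polynomials are $$H_{e_n}(x)=\sum_{i=0}^{\lfloor n/2\rfloor}\frac{(-1)^i\,n!\,x^{n-2i}}{(n-2i)!\,i!\,2^i},\qquad n=0,1,\dots$$ (orthogonal with respect to the standard normal density, with $H_{e_0}\equiv1$). Single-period regression problem: for given $K$, let $\psi_1=(\psi_{10},\dots,\psi_{1K})^\top$, $\Psi=\mathsf{E}[\psi_1(S_1)\psi_1(S_1)^\top]$, $\gamma=\mathsf{E}[Y\psi_1(S_1)]\in\mathbb{R}^{K+1}$, and $\beta=(\beta_0,\dots,\beta_K)^\top=\Psi^{-1}\gamma$. Given $N$ independent copies $(S_1^{(i)},Y^{(i)})$, $i=1,\dots,N$, of $(S_1,Y)$, let $\tilde\gamma$ have components $\tilde\gamma_k=\frac1N\sum_{i=1}^N Y^{(i)}\psi_{1k}(S_1^{(i)})$, $k=0,\dots,K$, and let $\tilde\beta=\Psi^{-1}\tilde\gamma$. The mean square error is $\mathsf{MSE}(\tilde\beta)=\mathsf{E}[|\tilde\beta-\beta|^2]$. *)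

theory Defs
  imports "HOL-Probability.Probability" "Jordan_Normal_Form.Gauss_Jordan_Elimination"
begin

(* Vectors and matrices are those of Jordan_Normal_Form, since the dimension K + 1 grows with N. *)
unbundle no vec_syntax
hide_const (open) Finite_Cartesian_Product.vec Finite_Cartesian_Product.mat

definition hermite_e :: "nat \<Rightarrow> real \<Rightarrow> real" where
  "hermite_e n x =
     (\<Sum>i = 0..n div 2. (-1) ^ i * fact n * x ^ (n - 2 * i) / (fact (n - 2 * i) * fact i * 2 ^ i))"

definition hermite_basis :: "real \<Rightarrow> nat \<Rightarrow> real \<Rightarrow> real" where
  "hermite_basis t k x = hermite_e k (x / sqrt t) / sqrt (fact k)"

definition standard_brownian_motion :: "'a measure \<Rightarrow> (real \<Rightarrow> 'a \<Rightarrow> real) \<Rightarrow> bool" where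
  "standard_brownian_motion M S \<longleftrightarrow>
     prob_space M \<and>
     (\<forall>t\<ge>0. S t \<in> borel_measurable M) \<and>
     (AE \<omega> in M. S 0 \<omega> = 0) \<and>
     (\<forall>n (\<tau> :: nat \<Rightarrow> real). 0 \<le> \<tau> 0 \<and> (\<forall>i<n. \<tau> i < \<tau> (Suc i)) \<longrightarrow>
        prob_space.indep_vars M (\<lambda>_. borel) (\<lambda>i \<omega>. S (\<tau> (Suc i)) \<omega> - S (\<tau> i) \<omega>) {..<n}) \<and>
     (\<forall>s t. 0 \<le> s \<and> s < t \<longrightarrow>
        distributed M lborel (\<lambda>\<omega>. S t \<omega> - S s \<omega>) (normal_density 0 (sqrt (t - s)))) \<and>
     (AE \<omega> in M. continuous_on {0..} (\<lambda>t. S t \<omega>))"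

definition independent_copies ::
  "'a measure \<Rightarrow> 'c measure \<Rightarrow> ('a \<Rightarrow> 'c) \<Rightarrow> nat \<Rightarrow> 'b measure \<Rightarrow> (nat \<Rightarrow> 'b \<Rightarrow> 'c) \<Rightarrow> bool" where
  "independent_copies M L X N Q Z \<longleftrightarrow>
     prob_space Q \<and>
     prob_space.indep_vars Q (\<lambda>_. L) Z {1..N} \<and>
     (\<forall>i\<in>{1..N}. distr Q L (Z i) = distr M L X)"

definition vec_norm2 :: "real vec \<Rightarrow> real" where
  "vec_norm2 v = L2_set (\<lambda>i. v $ i) {..<dim_vec v}"

definition gram_mat :: "'a measure \<Rightarrow> (nat \<Rightarrow> real \<Rightarrow> real) \<Rightarrow> nat \<Rightarrow> ('a \<Rightarrow> real) \<Rightarrow> real mat" where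
  "gram_mat M \<psi> K X =
     mat (K + 1) (K + 1) (\<lambda>(i, j). \<integral>\<omega>. \<psi> i (X \<omega>) * \<psi> j (X \<omega>) \<partial>M)"

definition cross_vec ::
  "'a measure \<Rightarrow> (nat \<Rightarrow> real \<Rightarrow> real) \<Rightarrow> nat \<Rightarrow> ('a \<Rightarrow> real) \<Rightarrow> ('a \<Rightarrow> real) \<Rightarrow> real vec" where
  "cross_vec M \<psi> K X Y = vec (K + 1) (\<lambda>k. \<integral>\<omega>. Y \<omega> * \<psi> k (X \<omega>) \<partial>M)"

definition regression_coeffs ::
  "'a measure \<Rightarrow> (nat \<Rightarrow> real \<Rightarrow> real) \<Rightarrow> nat \<Rightarrow> ('a \<Rightarrow> real) \<Rightarrow> ('a \<Rightarrow> real) \<Rightarrow> real vec" where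
  "regression_coeffs M \<psi> K X Y = the (mat_inverse (gram_mat M \<psi> K X)) *\<^sub>v cross_vec M \<psi> K X Y"

definition cross_vec_est ::
  "(nat \<Rightarrow> real \<Rightarrow> real) \<Rightarrow> nat \<Rightarrow> nat \<Rightarrow> (nat \<Rightarrow> 'b \<Rightarrow> real \<times> real) \<Rightarrow> 'b \<Rightarrow> real vec" where
  "cross_vec_est \<psi> K N Z \<omega> =
     vec (K + 1) (\<lambda>k. (\<Sum>i = 1..N. snd (Z i \<omega>) * \<psi> k (fst (Z i \<omega>))) / real N)"

definition regression_est ::
  "'a measure \<Rightarrow> (nat \<Rightarrow> real \<Rightarrow> real) \<Rightarrow> nat \<Rightarrow> ('a \<Rightarrow> real) \<Rightarrow>
   nat \<Rightarrow> (nat \<Rightarrow> 'b \<Rightarrow> real \<times> real) \<Rightarrow> 'b \<Rightarrow> real vec" where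
  "regression_est M \<psi> K X N Z \<omega> =
     the (mat_inverse (gram_mat M \<psi> K X)) *\<^sub>v cross_vec_est \<psi> K N Z \<omega>"

(* Valued in ennreal, so that suprema over unbounded families are infinite rather than arbitrary. *)
definition regression_mse ::
  "'a measure \<Rightarrow> (nat \<Rightarrow> real \<Rightarrow> real) \<Rightarrow> nat \<Rightarrow> ('a \<Rightarrow> real) \<Rightarrow> ('a \<Rightarrow> real) \<Rightarrow>
   nat \<Rightarrow> 'b measure \<Rightarrow> (nat \<Rightarrow> 'b \<Rightarrow> real \<times> real) \<Rightarrow> ennreal" where
  "regression_mse M \<psi> K X Y N Q Z =
     (\<integral>\<^sup>+ \<omega>. ennreal ((vec_norm2
        (regression_est M \<psi> K X N Z \<omega> - regression_coeffs M \<psi> K X Y))\<^sup>2) \<partial>Q)"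

definition hermite_payoff :: "real \<Rightarrow> real vec \<Rightarrow> real \<Rightarrow> real" where
  "hermite_payoff t a x = (\<Sum>k<dim_vec a. a $ k * hermite_basis t k x)"

end

theory Submission
  imports Defs "HOL-Real_Asymp.Real_Asymp"
begin

text \<open>
  Put r = sqrt (t1 / t2). The normalised values X1 and X2 of the Brownian motion are standard normal
  with correlation r, and E[He_n(X2) | X1] = r^n He_n(X1). Hence the Gram matrix is the identity,
  \<beta>_k = a_k r^k, and N times the mean square error is the sum of E[(Y \<psi>_1k(S_1))^2] over k minus
  |\<beta>|^2. Expanding squares of Hermite polynomials in Hermite polynomials gives, for the normalised
  polynomials h_n,
  E[h_j(X2)^2 h_k(X1)^2] = \<Sum>_i (j choose i) (k choose i) (2i choose i) r^(2i).
  As (2i choose i) is 4^i up to a factor 2i + 1, for j = k = K this is (1 + 2r)^(2K) up to a factor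
  polynomial in K. Cauchy-Schwarz applied to Y = \<Sum>_j (a_j r^j) (h_j(X2) / r^j) bounds the error over
  |\<beta>| = 1 by (K + 1)^2 ((1 + 2r) / r)^(2K) / N, and the payoff h_K / r^K attains this up to a
  polynomial factor. Since (1 + 2r) / r = 2 + sqrt \<rho>, the critical size of K is ln N / c.
\<close>

subsection \<open>Hermite polynomials\<close>

hide_const (open) module.smult

text \<open>The three-term recurrence serves as definition, and formal polynomials replace
  functions, so that \<open>pderiv\<close> and \<open>pcompose\<close> apply. The link to the
  explicit sum is \<open>hermite_e_eq_poly\<close>.\<close>

fun hermite_poly :: "nat \<Rightarrow> real poly" where
  "hermite_poly 0 = 1"
| "hermite_poly (Suc 0) = [:0, 1:]"
| "hermite_poly (Suc (Suc n)) =
     [:0, 1:] * hermite_poly (Suc n) - smult (real (Suc n)) (hermite_poly n)"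

lemma pderiv_hermite_poly_Suc:
  "pderiv (hermite_poly (Suc n)) = smult (real (Suc n)) (hermite_poly n)"
proof (induction n rule: hermite_poly.induct)
  case (3 n)
  have "pderiv (hermite_poly (Suc (Suc (Suc n)))) =
      hermite_poly (Suc (Suc n)) + [:0, 1:] * pderiv (hermite_poly (Suc (Suc n)))
      - smult (real (Suc (Suc n))) (pderiv (hermite_poly (Suc n)))"
    unfolding hermite_poly.simps(3)[of "Suc n"]
    by (simp only: pderiv_diff pderiv_mult pderiv_smult) (simp add: pderiv_pCons pderiv_mult algebra_simps del: hermite_poly.simps)
  \<comment> \<open>The two terms after the first amount to \<open>n + 2\<close> times the
    recurrence for \<open>hermite_poly (Suc (Suc n))\<close>.\<close>
  also have "\<dots> = smult (real (Suc (Suc (Suc n)))) (hermite_poly (Suc (Suc n)))"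
    unfolding 3 by (rule poly_eqI) (simp add: algebra_simps coeff_pCons split: nat.splits)
  finally show ?case .
qed (simp_all add: pderiv_pCons numeral_poly smult_diff_right pderiv_diff pderiv_mult one_pCons)

text \<open>The last term of the recurrence is a derivative by the previous lemma. This is the
  raising operator \<open>x - d/dx\<close>, the form suited to integration by parts.\<close>

lemma hermite_poly_Suc:
  "hermite_poly (Suc n) = [:0, 1:] * hermite_poly n - pderiv (hermite_poly n)"
  by (cases n) (simp_all add: pderiv_hermite_poly_Suc del: hermite_poly.simps(3), simp_all)

text \<open>The truncated \<open>n - 1\<close> is harmless at \<open>n = 0\<close>, where its factor
  vanishes. This allows the recurrence to be used without a case distinction.\<close>

lemma poly_hermite_poly_Suc:
  "poly (hermite_poly (Suc n)) x =
     x * poly (hermite_poly n) x - real n * poly (hermite_poly (n - 1)) x"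
  by (cases n) simp_all

text \<open>The recurrence already holds between single summands: term \<open>i + 1\<close> of order
  \<open>n + 2\<close> comes from term \<open>i + 1\<close> of order \<open>n + 1\<close> and term
  \<open>i\<close> of order \<open>n\<close>.\<close>

lemma hermite_e_Suc_Suc:
  "hermite_e (Suc (Suc n)) x = x * hermite_e (Suc n) x - real (Suc n) * hermite_e n x"
proof -
  \<comment> \<open>Padding with zeros beyond \<open>n div 2\<close> lets sums of different orders
    share one upper limit.\<close>
  define trm where "trm n i = (if 2 * i \<le> n then
    (-1) ^ i * fact n * x ^ (n - 2 * i) / (fact (n - 2 * i) * fact i * 2 ^ i) else 0)" for n i
  have trm_0: "trm n 0 = x ^ n" for n
    by (simp add: trm_def)
  have trm_sum: "hermite_e n x = (\<Sum>i\<le>m. trm n i)" if "n div 2 \<le> m" for n m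
    unfolding hermite_e_def
    by (rule sum.mono_neutral_cong_left) (use that in \<open>auto simp: trm_def\<close>)
  have step: "trm (Suc (Suc n)) (Suc i) = x * trm (Suc n) (Suc i) - real (Suc n) * trm n i" for i
  proof -
    \<comment> \<open>In the first case all three terms are padding. If \<open>n = 2 * i\<close>,
      only \<open>trm (Suc n) (Suc i)\<close> is. Otherwise none is, and the identity is one between
      factorials.\<close>
    consider "n < 2 * i" | "n = 2 * i" | d where "n = Suc (2 * i + d)"
      by (metis less_iff_Suc_add linorder_neqE_nat)
    then show ?thesis
    proof cases
      case 3
      have "real (fact d) > 0" "real (fact i) > 0" by simp_all
      then show ?thesis
        unfolding trm_def 3 by (simp add: divide_simps) (simp add: algebra_simps)
    next
      case 2
      then show ?thesis
        unfolding trm_def 2 by (simp add: divide_simps)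
    qed (simp add: trm_def)
  qed
  have "hermite_e (Suc (Suc n)) x = trm (Suc (Suc n)) 0 + (\<Sum>i\<le>n. trm (Suc (Suc n)) (Suc i))"
    by (subst trm_sum[of _ "Suc n"]) (simp_all add: sum.atMost_Suc_shift del: sum.atMost_Suc)
  also have "\<dots> = x * (trm (Suc n) 0 + (\<Sum>i\<le>n. trm (Suc n) (Suc i))) - real (Suc n) * (\<Sum>i\<le>n. trm n i)"
    unfolding step by (simp add: sum_subtractf sum_distrib_left algebra_simps trm_0)
  also have "trm (Suc n) 0 + (\<Sum>i\<le>n. trm (Suc n) (Suc i)) = hermite_e (Suc n) x"
    by (subst trm_sum[of _ "Suc n"]) (simp_all add: sum.atMost_Suc_shift del: sum.atMost_Suc)
  also have "(\<Sum>i\<le>n. trm n i) = hermite_e n x"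
    by (rule trm_sum[symmetric]) simp
  finally show ?thesis .
qed

lemma hermite_e_eq_poly: "hermite_e n x = poly (hermite_poly n) x"
proof (induction n rule: hermite_poly.induct)
  case (3 n)
  then show ?case by (simp add: hermite_e_Suc_Suc)
qed (simp_all add: hermite_e_def)

text \<open>The linearisation formula, by induction on \<open>m\<close>: the recurrence expresses
  order \<open>m + 1\<close> through orders \<open>m\<close> and \<open>m - 1\<close>, and Pascal's
  rule reassembles the coefficients. Indices \<open>l > m\<close> carry a zero binomial, so the
  truncated \<open>m + n - 2 * l\<close> does no harm.\<close>

lemma poly_hermite_poly_mult:
  "poly (hermite_poly m) x * poly (hermite_poly n) x =
     (\<Sum>l\<le>n. fact l * real (m choose l) * real (n choose l) * poly (hermite_poly (m + n - 2 * l)) x)"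
proof -
  define h where "h k = poly (hermite_poly k) x" for k
  have h_Suc: "x * h k = h (Suc k) + real k * h (k - 1)" for k
    by (simp add: h_def poly_hermite_poly_Suc)
  define claim where "claim m \<longleftrightarrow> h m * h n =
     (\<Sum>l\<le>n. fact l * real (m choose l) * real (n choose l) * h (m + n - 2 * l))" for m
  have "claim 0"
  proof -
    have "(\<Sum>l\<le>n. fact l * real (0 choose l) * real (n choose l) * h (0 + n - 2 * l))
       = (\<Sum>l\<in>{0}. fact l * real (0 choose l) * real (n choose l) * h (0 + n - 2 * l))"
      by (rule sum.mono_neutral_right) auto
    then show ?thesis by (simp add: claim_def h_def)
  qed
  moreover have "claim (Suc m)" if "claim m" "claim (m - 1)" for m
  proof -
    let ?A = "\<lambda>l. fact l * real (m choose l) * real (n choose l) * h (Suc m + n - 2 * l)"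
    let ?B = "\<lambda>l. fact (Suc l) * real (m choose l) * real (n choose Suc l) * h (Suc m + n - 2 * Suc l)"
    \<comment> \<open>For \<open>l >= m\<close> both sides vanish, so the factor
      \<open>real m - real l\<close> may be used for all \<open>l\<close>.\<close>
    have absorb: "real m * real ((m - 1) choose l) = (real m - real l) * real (m choose l)" for l
    proof (cases "l < m")
      case True
      have "m * ((m - 1) choose l) = (m - l) * (m choose l)"
        using binomial_absorb_comp[of m l] by simp
      then have "real (m * ((m - 1) choose l)) = real ((m - l) * (m choose l))"
        by (rule arg_cong)
      then show ?thesis using True by (simp add: of_nat_diff)
    qed (cases "l = m"; cases m; simp add: binomial_eq_0)
    have prev: "real m * (h (m - 1) * h n) = (\<Sum>l\<le>n. fact l * ((real m - real l) * real (m choose l))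
        * real (n choose l) * h (m + n - 2 * l - 1))"
    proof (cases m)
      case 0
      have "(real 0 - real l) * real (0 choose l) = 0" for l by (cases l) simp_all
      then show ?thesis using 0 by (simp only:) simp
    next
      case (Suc k)
      show ?thesis
        unfolding that(2)[unfolded claim_def] sum_distrib_left absorb[symmetric]
        by (intro sum.cong refl) (simp add: Suc)
    qed
    \<comment> \<open>Multiplying by \<open>x\<close> lowers the order with factor
      \<open>m + n - 2 * l\<close>. It is split as \<open>(m - l) + (n - l)\<close> because the
      first part is exactly what \<open>prev\<close> subtracts.\<close>
    have times: "x * (h m * h n) = (\<Sum>l\<le>n. ?A l + fact l * real (m choose l) * real (n choose l) *
        ((real m - real l) + (real n - real l)) * h (m + n - 2 * l - 1))"
      unfolding that(1)[unfolded claim_def] sum_distrib_left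
    proof (intro sum.cong refl)
      fix l assume "l \<in> {..n}"
      show "x * (fact l * real (m choose l) * real (n choose l) * h (m + n - 2 * l)) =
        ?A l + fact l * real (m choose l) * real (n choose l) *
        ((real m - real l) + (real n - real l)) * h (m + n - 2 * l - 1)"
      proof (cases "l \<le> m")
        case True
        then have "Suc (m + n - 2 * l) = Suc m + n - 2 * l"
          "real (m + n - 2 * l) = (real m - real l) + (real n - real l)"
          using \<open>l \<in> {..n}\<close> by (auto simp: of_nat_diff)
        then have "x * h (m + n - 2 * l) = h (Suc m + n - 2 * l)
            + ((real m - real l) + (real n - real l)) * h (m + n - 2 * l - 1)"
          using h_Suc[of "m + n - 2 * l"] by simp
        moreover have "x * (C * u) = C * v + C * w * z" if "x * u = v + w * z" for C u v w z :: real
          by (metis that distrib_left mult.assoc mult.left_commute)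
        ultimately show ?thesis by blast
      qed (simp add: binomial_eq_0)
    qed
    have "h (Suc m) * h n = x * (h m * h n) - real m * (h (m - 1) * h n)"
      by (simp add: mult.assoc[symmetric] h_Suc distrib_right)
    also have "\<dots> = (\<Sum>l\<le>n. ?A l + fact l * real (m choose l) *
        ((real n - real l) * real (n choose l)) * h (m + n - 2 * l - 1))"
      unfolding prev times sum_subtractf[symmetric]
      by (intro sum.cong refl) (simp add: algebra_simps)
    also have "\<dots> = (\<Sum>l\<le>n. ?A l) + (\<Sum>l\<le>n. ?B l)"
    proof -
      have step: "fact l * real (m choose l) * ((real n - real l) * real (n choose l)) * h (m + n - 2 * l - 1) = ?B l"
        if "l \<le> n" for l
      proof -
        have "Suc l * (n choose Suc l) = (n - l) * (n choose l)"
          by (simp only: binomial_absorption binomial_absorb_comp)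
        then have "real (Suc l) * real (n choose Suc l) = real (n - l) * real (n choose l)"
          by (metis of_nat_mult)
        then have absorb': "(real n - real l) * real (n choose l) = real (Suc l) * real (n choose Suc l)"
          using that by (simp only: of_nat_diff)
        have index: "m + n - 2 * l - 1 = Suc m + n - 2 * Suc l"
          by simp
        show ?thesis
          unfolding absorb' index fact_Suc by (simp only: mult_ac)
      qed
      show ?thesis
        unfolding sum.distrib by (intro arg_cong2[where f = "(+)"] refl sum.cong step) simp
    qed
    \<comment> \<open>The sum may be extended to \<open>Suc n\<close>, since
      \<open>n choose Suc n = 0\<close>, and then shifted to match the indices of
      \<open>?B\<close>.\<close>
    also have "(\<Sum>l\<le>n. ?A l) = ?A 0 + (\<Sum>l\<le>n. ?A (Suc l))"
      using sum.atMost_Suc[of ?A n] sum.atMost_Suc_shift[of ?A n] by (simp add: binomial_eq_0)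
    \<comment> \<open>Pascal's rule in \<open>m\<close> merges \<open>?A (Suc l)\<close> with
      \<open>?B l\<close>.\<close>
    also have "?A 0 + (\<Sum>l\<le>n. ?A (Suc l)) + (\<Sum>l\<le>n. ?B l) = (\<Sum>l\<le>Suc n.
        fact l * real (Suc m choose l) * real (n choose l) * h (Suc m + n - 2 * l))"
      unfolding sum.atMost_Suc_shift by (simp add: sum.distrib algebra_simps)
    finally show ?thesis by (simp add: claim_def)
  qed
  \<comment> \<open>The recurrence reaches back two orders, so the induction carries two consecutive
    claims.\<close>
  ultimately have "claim m \<and> claim (m - 1)"
    by (induction m) auto
  then show ?thesis by (simp add: claim_def h_def)
qed

text \<open>The linearisation formula on the diagonal, read backwards through
  \<open>i = n - l\<close>; only even orders occur there.\<close>

lemma hermite_poly_square: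
  "(hermite_poly n)\<^sup>2 =
     (\<Sum>i\<le>n. smult (fact n * real (n choose i) / fact i) (hermite_poly (2 * i)))"
proof (rule poly_eq_poly_eq_iff[THEN iffD1], rule ext)
  fix x
  have "poly ((hermite_poly n)\<^sup>2) x = (\<Sum>l\<le>n. fact l * real (n choose l) * real (n choose l)
      * poly (hermite_poly (2 * (n - l))) x)"
    by (simp add: power2_eq_square poly_hermite_poly_mult diff_mult_distrib2 mult_2[symmetric])
  also have "\<dots> = (\<Sum>i\<le>n. fact (n - i) * (real (n choose i))\<^sup>2 * poly (hermite_poly (2 * i)) x)"
    by (rule sum.reindex_bij_witness[of _ "\<lambda>i. n - i" "\<lambda>i. n - i"])
      (auto simp: binomial_symmetric[symmetric] power2_eq_square)
  also have "\<dots> = (\<Sum>i\<le>n. (fact n * real (n choose i) / fact i) * poly (hermite_poly (2 * i)) x)"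
  proof (intro sum.cong refl)
    fix i assume "i \<in> {..n}"
    then have "fact (n - i) * real (n choose i) = fact n / fact i"
      by (simp add: binomial_fact)
    moreover have "fact (n - i) * (real (n choose i))\<^sup>2 = fact (n - i) * real (n choose i) * real (n choose i)"
      by (simp add: power2_eq_square)
    ultimately show "fact (n - i) * (real (n choose i))\<^sup>2 * poly (hermite_poly (2 * i)) x =
       (fact n * real (n choose i) / fact i) * poly (hermite_poly (2 * i)) x"
      by simp
  qed
  finally show "poly ((hermite_poly n)\<^sup>2) x = poly (\<Sum>i\<le>n. smult (fact n * real (n choose i) / fact i)
      (hermite_poly (2 * i))) x"
    by (simp add: poly_sum)
qed

subsection \<open>Gaussian integrals\<close>

definition std_gauss :: "real measure" where
  "std_gauss = density lborel std_normal_density"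

lemma prob_space_std_gauss: "prob_space std_gauss"
  unfolding std_gauss_def by (rule prob_space_normal_density) simp

lemma sets_std_gauss [simp, measurable_cong]: "sets std_gauss = sets borel"
  by (simp add: std_gauss_def)

lemma space_std_gauss [simp]: "space std_gauss = UNIV"
  by (simp add: std_gauss_def)

lemma integrable_power_std_gauss: "integrable std_gauss (\<lambda>x. x ^ n)"
  unfolding std_gauss_def using integrable_std_normal_moment[of n]
  by (subst integrable_density) auto

text \<open>Integration by parts for monomials, read off from the known moments: the odd ones
  vanish, and the even ones are \<open>fact (2 * k) / (2 ^ k * fact k)\<close>.\<close>

lemma integral_power_std_gauss_Suc:
  "(\<integral>x. x ^ Suc n \<partial>std_gauss) = real n * (\<integral>x. x ^ (n - 1) \<partial>std_gauss)"
proof -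
  have lebesgue: "(\<integral>x. x ^ n \<partial>std_gauss) = (\<integral>x. std_normal_density x * x ^ n \<partial>lborel)" for n
    by (simp add: std_gauss_def integral_density)
  show ?thesis
  proof (cases "even n")
    case True
    then obtain k where n: "n = 2 * k" by (elim evenE)
    show ?thesis
    proof (cases k)
      case (Suc j)
      then have "n - 1 = 2 * j + 1" "Suc n = 2 * k + 1" using n by simp_all
      then show ?thesis by (simp only: lebesgue integral_std_normal_moment_odd)
    qed (use n lebesgue[of 1] integral_std_normal_moment_odd[of 0] in simp)
  next
    case False
    then obtain k where n: "n = 2 * k + 1" by (elim oddE)
    then have *: "Suc n = 2 * Suc k" "n - 1 = 2 * k" by simp_all
    have moment: "fact (2 * Suc k) / (2 ^ Suc k * fact (Suc k)) = real n * (fact (2 * k) / (2 ^ k * fact k))"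
      using n by (simp add: divide_simps)
    show ?thesis unfolding * lebesgue integral_std_normal_moment_even by (rule moment)
  qed
qed

lemma integrable_poly_std_gauss: "integrable std_gauss (poly p)"
  unfolding poly_altdef[abs_def] by (intro Bochner_Integration.integrable_sum integrable_mult_right integrable_power_std_gauss)

text \<open>Gaussian integration by parts follows from the monomial case by linearity.\<close>

lemma stein_identity_std_gauss:
  "(\<integral>x. x * poly p x \<partial>std_gauss) = (\<integral>x. poly (pderiv p) x \<partial>std_gauss)"
proof -
  have deriv: "poly (pderiv p) x = (\<Sum>i\<le>degree p. coeff p i * real i * x ^ (i - 1))" for x
  proof -
    have "pderiv p = (\<Sum>i\<le>degree p. pderiv (monom (coeff p i) i))"
      by (subst poly_as_sum_of_monoms[of p, symmetric]) (use higher_pderiv_sum[of 1] in simp)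
    then show ?thesis by (simp add: pderiv_monom poly_sum poly_monom mult.commute)
  qed
  have "(\<integral>x. x * poly p x \<partial>std_gauss) = (\<integral>x. (\<Sum>i\<le>degree p. coeff p i * x ^ Suc i) \<partial>std_gauss)"
    by (simp add: poly_altdef sum_distrib_left algebra_simps)
  also have "\<dots> = (\<Sum>i\<le>degree p. coeff p i * (\<integral>x. x ^ Suc i \<partial>std_gauss))"
    by (subst Bochner_Integration.integral_sum)
      (intro integrable_mult_right integrable_power_std_gauss, simp del: power_Suc)
  also have "\<dots> = (\<Sum>i\<le>degree p. coeff p i * real i * (\<integral>x. x ^ (i - 1) \<partial>std_gauss))"
    unfolding integral_power_std_gauss_Suc by (simp add: mult.assoc)
  also have "\<dots> = (\<integral>x. poly (pderiv p) x \<partial>std_gauss)"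
    unfolding deriv
    by (subst Bochner_Integration.integral_sum)
      (intro integrable_mult_right integrable_power_std_gauss, simp)
  finally show ?thesis .
qed

text \<open>Under the Gaussian law the raising operator is adjoint to differentiation: Stein's
  identity for the product of \<open>hermite_poly n\<close> and \<open>q\<close> yields two terms,
  one of which cancels against the derivative of \<open>hermite_poly n\<close>.\<close>

lemma integral_hermite_poly_Suc_mult:
  "(\<integral>x. poly (hermite_poly (Suc n)) x * poly q x \<partial>std_gauss) =
     (\<integral>x. poly (hermite_poly n) x * poly (pderiv q) x \<partial>std_gauss)"
proof -
  let ?h = "hermite_poly n"
  have "(\<integral>x. poly (hermite_poly (Suc n)) x * poly q x \<partial>std_gauss) =
     (\<integral>x. poly ([:0, 1:] * (?h * q)) x - poly (pderiv ?h * q) x \<partial>std_gauss)"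
    by (simp add: hermite_poly_Suc algebra_simps)
  also have "\<dots> = (\<integral>x. poly ([:0, 1:] * (?h * q)) x \<partial>std_gauss) - (\<integral>x. poly (pderiv ?h * q) x \<partial>std_gauss)"
    by (intro Bochner_Integration.integral_diff integrable_poly_std_gauss)
  also have "(\<integral>x. poly ([:0, 1:] * (?h * q)) x \<partial>std_gauss) = (\<integral>x. poly (pderiv (?h * q)) x \<partial>std_gauss)"
    unfolding stein_identity_std_gauss[symmetric] by simp
  also have "(\<integral>x. poly (pderiv (?h * q)) x \<partial>std_gauss) - (\<integral>x. poly (pderiv ?h * q) x \<partial>std_gauss)
    = (\<integral>x. poly (pderiv (?h * q)) x - poly (pderiv ?h * q) x \<partial>std_gauss)"
    by (intro Bochner_Integration.integral_diff[symmetric] integrable_poly_std_gauss)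
  finally show ?thesis by (simp add: pderiv_mult algebra_simps)
qed

text \<open>Each use of the adjointness lowers both orders by one and yields the factor
  \<open>n\<close>, until one order is zero.\<close>

lemma integral_hermite_poly_mult:
  "(\<integral>x. poly (hermite_poly m) x * poly (hermite_poly n) x \<partial>std_gauss) = (if m = n then fact n else 0)"
proof (induction m arbitrary: n)
  case 0
  show ?case
  proof (cases n)
    case 0
    then show ?thesis using prob_space.prob_space[OF prob_space_std_gauss] by simp
  next
    case (Suc k)
    then show ?thesis
      using integral_hermite_poly_Suc_mult[of k 1] by (simp add: mult.commute)
  qed
next
  case (Suc m)
  show ?case
  proof (cases n)
    case 0
    then show ?thesis using integral_hermite_poly_Suc_mult[of m 1] by simp
  next
    case (Suc k)
    then show ?thesis
      by (simp add: integral_hermite_poly_Suc_mult pderiv_hermite_poly_Suc Suc.IH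
          mult.left_commute[of _ "real (Suc k)"] del: of_nat_Suc hermite_poly.simps)
  qed
qed

text \<open>Hermite polynomials are eigenfunctions of the Ornstein-Uhlenbeck semigroup. In
  probabilistic terms this is the conditional expectation given the first of two standard normals
  with correlation \<open>r\<close>.\<close>

lemma integral_hermite_poly_affine:
  fixes r s x :: real
  assumes "r\<^sup>2 + s\<^sup>2 = 1"
  shows "(\<integral>y. poly (hermite_poly n) (r * x + s * y) \<partial>std_gauss) = r ^ n * poly (hermite_poly n) x"
proof -
  have affine: "poly p (r * x + s * y) = poly (pcompose p [:r * x, s:]) y" for p y
    by (simp add: poly_pcompose mult.commute)
  define T where "T p = (\<integral>y. poly p (r * x + s * y) \<partial>std_gauss)" for p
  have int: "integrable std_gauss (\<lambda>y. poly p (r * x + s * y))" for p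
    unfolding affine by (rule integrable_poly_std_gauss)
  have stein: "(\<integral>y. y * poly p (r * x + s * y) \<partial>std_gauss) = s * T (pderiv p)" for p
  proof -
    have "poly (pderiv (pcompose p [:r * x, s:])) y = s * poly (pderiv p) (r * x + s * y)" for y
      by (simp add: pderiv_pcompose pderiv_pCons affine mult.commute)
    then have "(\<integral>y. poly (pderiv (pcompose p [:r * x, s:])) y \<partial>std_gauss) = s * T (pderiv p)"
      by (simp only: T_def integral_mult_right_zero)
    then show ?thesis
      by (simp only: affine[of p] stein_identity_std_gauss)
  qed
  have int_id: "integrable std_gauss (\<lambda>y. y * poly p (r * x + s * y))" for p
  proof -
    have "(\<lambda>y. y * poly p (r * x + s * y)) = poly ([:0, 1:] * pcompose p [:r * x, s:])"
      by (auto simp: affine)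
    then show ?thesis by (simp only: integrable_poly_std_gauss)
  qed
  \<comment> \<open>The raising operator multiplies by \<open>r * x + s * y\<close>. The part
    \<open>r * x\<close> is constant in \<open>y\<close>, Stein's identity turns
    \<open>s * y\<close> into \<open>s^2\<close> times a derivative, and
    \<open>1 - s^2 = r^2\<close> remains.\<close>
  have T_Suc: "T (hermite_poly (Suc n)) =
      r * x * T (hermite_poly n) - r\<^sup>2 * T (pderiv (hermite_poly n))" for n
  proof -
    let ?h = "hermite_poly n"
    have "T (hermite_poly (Suc n)) = (\<integral>y. r * x * poly ?h (r * x + s * y)
        + s * (y * poly ?h (r * x + s * y)) - poly (pderiv ?h) (r * x + s * y) \<partial>std_gauss)"
      unfolding T_def hermite_poly_Suc by (simp add: algebra_simps)
    also have "\<dots> = r * x * T ?h + s * (s * T (pderiv ?h)) - T (pderiv ?h)"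
      using int int_id stein[of ?h]
      by (simp add: T_def Bochner_Integration.integral_diff Bochner_Integration.integral_add)
    also have "\<dots> = r * x * T ?h - (1 - s\<^sup>2) * T (pderiv ?h)"
      by (simp add: algebra_simps power2_eq_square)
    also have "1 - s\<^sup>2 = r\<^sup>2"
      using assms by simp
    finally show ?thesis .
  qed
  have T_smult: "T (smult c p) = c * T p" for c p
    by (simp add: T_def)
  have "T (hermite_poly n) = r ^ n * poly (hermite_poly n) x"
  proof (induction n rule: hermite_poly.induct)
    case 1
    then show ?case using prob_space.prob_space[OF prob_space_std_gauss] by (simp add: T_def)
  next
    case 2
    show ?case
      using T_Suc[of 0] prob_space.prob_space[OF prob_space_std_gauss] by (simp add: T_def)
  next
    case (3 n)
    show ?case
      unfolding T_Suc[of "Suc n"] pderiv_hermite_poly_Suc T_smult 3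
      by (simp add: algebra_simps power2_eq_square)
  qed
  then show ?thesis by (simp add: T_def)
qed

section \<open>Integrals over pairs of standard normals\<close>

lemma integrable_powers_std_gauss_pair:
  "integrable (std_gauss \<Otimes>\<^sub>M std_gauss) (\<lambda>z. fst z ^ m * snd z ^ n)"
proof -
  interpret prob_space std_gauss by (rule prob_space_std_gauss)
  interpret pair_sigma_finite std_gauss std_gauss ..
  show ?thesis
    by (rule Fubini_integrable)
      (auto simp: abs_mult simp del: power_abs intro!: integrable_mult_left integrable_abs integrable_power_std_gauss)
qed

lemma integrable_poly_std_gauss_pair:
  "integrable (std_gauss \<Otimes>\<^sub>M std_gauss) (\<lambda>z. poly p (fst z) * poly q (r * fst z + s * snd z))"
proof -
  \<comment> \<open>The exponents \<open>m\<close> and \<open>n\<close> are general because each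
    step of the induction on \<open>q\<close> multiplies by \<open>r * fst z + s * snd z\<close> and
    so raises one of them.\<close>
  have *: "integrable (std_gauss \<Otimes>\<^sub>M std_gauss)
      (\<lambda>z. fst z ^ m * snd z ^ n * poly q (r * fst z + s * snd z))" for m n
  proof (induction q arbitrary: m n)
    case (pCons a q)
    have "integrable (std_gauss \<Otimes>\<^sub>M std_gauss) (\<lambda>z. a * (fst z ^ m * snd z ^ n)
        + r * (fst z ^ Suc m * snd z ^ n * poly q (r * fst z + s * snd z))
        + s * (fst z ^ m * snd z ^ Suc n * poly q (r * fst z + s * snd z)))"
      by (intro Bochner_Integration.integrable_add integrable_mult_right
          integrable_powers_std_gauss_pair pCons.IH)
    then show ?case by (simp add: algebra_simps)
  qed simp
  have "integrable (std_gauss \<Otimes>\<^sub>M std_gauss)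
      (\<lambda>z. \<Sum>i\<le>degree p. coeff p i * (fst z ^ i * snd z ^ 0 * poly q (r * fst z + s * snd z)))"
    by (intro Bochner_Integration.integrable_sum integrable_mult_right *)
  then show ?thesis by (simp add: poly_altdef[of p] sum_distrib_right mult.assoc)
qed

text \<open>For \<open>r^2 <= 1\<close> this is the law of two standard normals with correlation
  \<open>r\<close>, built from two independent ones.\<close>

definition std_gauss_pair :: "real \<Rightarrow> (real \<times> real) measure" where
  "std_gauss_pair r = distr (std_gauss \<Otimes>\<^sub>M std_gauss) borel
     (\<lambda>z. (fst z, r * fst z + sqrt (1 - r\<^sup>2) * snd z))"

lemma borel_measurable_poly [measurable]: "poly (p :: real poly) \<in> borel_measurable borel"
  by (intro borel_measurable_continuous_onI continuous_intros)

lemma measurable_std_gauss_pair: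
  "(\<lambda>z. (fst z, r * fst z + s * snd z)) \<in> std_gauss \<Otimes>\<^sub>M std_gauss \<rightarrow>\<^sub>M (borel :: (real \<times> real) measure)"
  unfolding borel_prod[symmetric] by measurable

lemma borel_measurable_fst_snd_poly:
  "(\<lambda>z :: real \<times> real. poly p (fst z) * poly q (snd z)) \<in> borel_measurable borel"
  unfolding borel_prod[symmetric] by measurable

lemma integrable_std_gauss_pair:
  "integrable (std_gauss_pair r) (\<lambda>z. poly p (fst z) * poly q (snd z))"
  unfolding std_gauss_pair_def
  by (subst integrable_distr_eq)
    (use integrable_poly_std_gauss_pair in \<open>auto intro: measurable_std_gauss_pair borel_measurable_fst_snd_poly\<close>)

text \<open>By Fubini the second coordinate is integrated first;
  \<open>integral_hermite_poly_affine\<close> yields \<open>r ^ n\<close> and a polynomial in the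
  first coordinate, to which orthogonality applies.\<close>

lemma integral_hermite_poly_std_gauss_pair:
  assumes "r\<^sup>2 \<le> 1"
  shows "(\<integral>z. poly (hermite_poly m) (fst z) * poly (hermite_poly n) (snd z) \<partial>std_gauss_pair r) =
    (if m = n then r ^ n * fact n else 0)"
proof -
  interpret prob_space std_gauss by (rule prob_space_std_gauss)
  interpret pair_sigma_finite std_gauss std_gauss ..
  let ?s = "sqrt (1 - r\<^sup>2)"
  have "(\<integral>z. poly (hermite_poly m) (fst z) * poly (hermite_poly n) (snd z) \<partial>std_gauss_pair r) =
    (\<integral>z. poly (hermite_poly m) (fst z) * poly (hermite_poly n) (r * fst z + ?s * snd z)
       \<partial>(std_gauss \<Otimes>\<^sub>M std_gauss))"
    unfolding std_gauss_pair_def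
    by (subst integral_distr) (auto intro: measurable_std_gauss_pair borel_measurable_fst_snd_poly)
  also have "\<dots> = (\<integral>x. \<integral>y. poly (hermite_poly m) x * poly (hermite_poly n) (r * x + ?s * y)
      \<partial>std_gauss \<partial>std_gauss)"
    by (subst integral_fst'[symmetric]) (use integrable_poly_std_gauss_pair in auto)
  also have "\<dots> = (\<integral>x. r ^ n * (poly (hermite_poly m) x * poly (hermite_poly n) x) \<partial>std_gauss)"
    using assms by (simp add: integral_hermite_poly_affine mult.left_commute)
  finally show ?thesis by (simp add: integral_hermite_poly_mult)
qed

text \<open>Both squares are expanded in even Hermite polynomials, and orthogonality keeps the
  diagonal. The central binomial is \<open>fact (2 * i)\<close> from the norm over the two factors
  \<open>fact i\<close> from the expansions.\<close>

lemma integral_hermite_poly_squares_std_gauss_pair: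
  assumes "r\<^sup>2 \<le> 1"
  shows "(\<integral>z. poly ((hermite_poly m)\<^sup>2) (fst z) * poly ((hermite_poly n)\<^sup>2) (snd z) \<partial>std_gauss_pair r) =
    fact m * fact n * (\<Sum>i\<le>m. real (m choose i) * real (n choose i) * real (2 * i choose i) * r ^ (2 * i))"
proof -
  define c where "c n i = fact n * real (n choose i) / fact i" for n i
  define g where "g i j = (\<integral>z. poly (hermite_poly (2 * i)) (fst z) * poly (hermite_poly (2 * j)) (snd z)
     \<partial>std_gauss_pair r)" for i j
  have "poly ((hermite_poly m)\<^sup>2) x * poly ((hermite_poly n)\<^sup>2) y = (\<Sum>i\<le>m. \<Sum>j\<le>n.
      c m i * c n j * (poly (hermite_poly (2 * i)) x * poly (hermite_poly (2 * j)) y))" for x y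
    unfolding hermite_poly_square c_def[symmetric]
    by (simp add: poly_sum sum_product mult.assoc mult.left_commute)
  then have "(\<integral>z. poly ((hermite_poly m)\<^sup>2) (fst z) * poly ((hermite_poly n)\<^sup>2) (snd z) \<partial>std_gauss_pair r) =
    (\<Sum>i\<le>m. \<Sum>j\<le>n. c m i * c n j * g i j)"
    by (simp only:) (simp add: g_def Bochner_Integration.integral_sum integrable_std_gauss_pair)
  also have "\<dots> = (\<Sum>i\<le>m. c m i * c n i * (r ^ (2 * i) * fact (2 * i)))"
  proof (intro sum.cong refl)
    fix i
    have "(\<Sum>j\<le>n. c m i * c n j * g i j) =
      (\<Sum>j\<le>n. if j = i then c m i * c n i * (r ^ (2 * i) * fact (2 * i)) else 0)"
      by (rule sum.cong)
        (auto simp: g_def integral_hermite_poly_std_gauss_pair[OF assms] simp del: fact_Suc)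
    \<comment> \<open>For \<open>i > n\<close> the index \<open>i\<close> is missing from the sum,
      but then \<open>c n i = 0\<close> as well.\<close>
    also have "\<dots> = c m i * c n i * (r ^ (2 * i) * fact (2 * i))"
      by (simp add: c_def)
    finally show "(\<Sum>j\<le>n. c m i * c n j * g i j) = c m i * c n i * (r ^ (2 * i) * fact (2 * i))" .
  qed
  also have "\<dots> = fact m * fact n *
      (\<Sum>i\<le>m. real (m choose i) * real (n choose i) * real (2 * i choose i) * r ^ (2 * i))"
    unfolding sum_distrib_left
    by (intro sum.cong refl) (simp add: c_def binomial_fact mult_2 mult_ac)
  finally show ?thesis .
qed

section \<open>The normalised Hermite basis under the pair law\<close>

lemma hermite_basis_scale: "hermite_basis t k x = hermite_basis 1 k (x / sqrt t)"
  by (simp add: hermite_basis_def)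

text \<open>Together with \<open>hermite_basis_scale\<close> this moves the times into the
  arguments, so that all expectations become integrals over \<open>std_gauss_pair\<close>.\<close>

lemma hermite_payoff_scale: "hermite_payoff t a x = hermite_payoff 1 a (x / sqrt t)"
  by (simp add: hermite_payoff_def hermite_basis_scale[of t])

lemma hermite_basis_eq_poly:
  "hermite_basis 1 k x = poly (smult (1 / sqrt (fact k)) (hermite_poly k)) x"
  by (simp add: hermite_basis_def hermite_e_eq_poly)

lemma hermite_payoff_eq_poly:
  "hermite_payoff 1 a x = poly (\<Sum>k<dim_vec a. smult (a $ k / sqrt (fact k)) (hermite_poly k)) x"
  by (simp add: hermite_payoff_def hermite_basis_eq_poly poly_sum)

lemma integrable_hermite_std_gauss_pair:
  "integrable (std_gauss_pair r) (\<lambda>z. hermite_basis 1 i (fst z) * hermite_basis 1 j (fst z))"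
  "integrable (std_gauss_pair r) (\<lambda>z. hermite_basis 1 j (snd z) * hermite_basis 1 k (fst z))"
  "integrable (std_gauss_pair r) (\<lambda>z. (hermite_basis 1 j (snd z) * hermite_basis 1 k (fst z))\<^sup>2)"
  "integrable (std_gauss_pair r) (\<lambda>z. (hermite_payoff 1 a (snd z) * hermite_basis 1 k (fst z))\<^sup>2)"
proof -
  have *: "integrable (std_gauss_pair r) (\<lambda>z. poly q (snd z) * poly p (fst z))" for p q
    using integrable_std_gauss_pair[of r p q] by (simp only: mult.commute)
  show "integrable (std_gauss_pair r) (\<lambda>z. hermite_basis 1 i (fst z) * hermite_basis 1 j (fst z))"
    using *[of 1 "smult (1 / sqrt (fact i)) (hermite_poly i) * smult (1 / sqrt (fact j)) (hermite_poly j)"]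
    by (simp add: hermite_basis_eq_poly mult.commute)
  show "integrable (std_gauss_pair r) (\<lambda>z. hermite_basis 1 j (snd z) * hermite_basis 1 k (fst z))"
    "integrable (std_gauss_pair r) (\<lambda>z. (hermite_basis 1 j (snd z) * hermite_basis 1 k (fst z))\<^sup>2)"
    "integrable (std_gauss_pair r) (\<lambda>z. (hermite_payoff 1 a (snd z) * hermite_basis 1 k (fst z))\<^sup>2)"
    unfolding hermite_payoff_eq_poly hermite_basis_eq_poly power_mult_distrib poly_power[symmetric]
    by (rule *)+
qed

text \<open>The first coordinate is standard normal, so this is orthogonality divided by the norms.
  It makes the Gram matrix the identity.\<close>

lemma integral_hermite_basis_std_gauss_pair:
  "(\<integral>z. hermite_basis 1 i (fst z) * hermite_basis 1 j (fst z) \<partial>std_gauss_pair r) = (if i = j then 1 else 0)"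
proof -
  interpret prob_space std_gauss by (rule prob_space_std_gauss)
  interpret pair_sigma_finite std_gauss std_gauss ..
  have fst: "(\<integral>z. poly p (fst z) \<partial>std_gauss_pair r) = (\<integral>x. poly p x \<partial>std_gauss)" for p
  proof -
    have "(\<integral>z. poly p (fst z) \<partial>std_gauss_pair r) = (\<integral>z. poly p (fst z) \<partial>(std_gauss \<Otimes>\<^sub>M std_gauss))"
      unfolding std_gauss_pair_def using borel_measurable_fst_snd_poly[of p 1]
      by (subst integral_distr) (auto intro: measurable_std_gauss_pair)
    also have "\<dots> = (\<integral>x. \<integral>y. poly p x \<partial>std_gauss \<partial>std_gauss)"
      using integrable_poly_std_gauss_pair[of p 1] by (subst integral_fst'[symmetric]) simp_all
    finally show ?thesis using prob_space by simp
  qed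
  have "(\<integral>z. hermite_basis 1 i (fst z) * hermite_basis 1 j (fst z) \<partial>std_gauss_pair r) =
    (\<integral>z. poly (smult (1 / (sqrt (fact i) * sqrt (fact j))) (hermite_poly i * hermite_poly j)) (fst z) \<partial>std_gauss_pair r)"
    by (simp add: hermite_basis_eq_poly)
  also have "\<dots> = (\<integral>x. poly (smult (1 / (sqrt (fact i) * sqrt (fact j))) (hermite_poly i * hermite_poly j)) x \<partial>std_gauss)"
    by (rule fst)
  also have "\<dots> = (\<integral>x. 1 / (sqrt (fact i) * sqrt (fact j)) * (poly (hermite_poly i) x * poly (hermite_poly j) x) \<partial>std_gauss)"
    by (intro Bochner_Integration.integral_cong refl) simp
  finally show ?thesis
    by (simp only: integral_mult_right_zero integral_hermite_poly_mult) simp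
qed

lemma integral_hermite_basis_cross_std_gauss_pair:
  assumes "r\<^sup>2 \<le> 1"
  shows "(\<integral>z. hermite_basis 1 j (snd z) * hermite_basis 1 k (fst z) \<partial>std_gauss_pair r) = (if j = k then r ^ k else 0)"
proof -
  have "(\<integral>z. hermite_basis 1 j (snd z) * hermite_basis 1 k (fst z) \<partial>std_gauss_pair r) =
    (\<integral>z. 1 / (sqrt (fact j) * sqrt (fact k)) * (poly (hermite_poly k) (fst z) * poly (hermite_poly j) (snd z)) \<partial>std_gauss_pair r)"
    by (simp add: hermite_basis_eq_poly mult.commute)
  then show ?thesis
    by (simp only: integral_mult_right_zero) (simp add: integral_hermite_poly_std_gauss_pair[OF assms])
qed

lemma integral_hermite_payoff_std_gauss_pair:
  assumes "r\<^sup>2 \<le> 1" "k < dim_vec a"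
  shows "(\<integral>z. hermite_payoff 1 a (snd z) * hermite_basis 1 k (fst z) \<partial>std_gauss_pair r) = a $ k * r ^ k"
proof -
  have "(\<integral>z. hermite_payoff 1 a (snd z) * hermite_basis 1 k (fst z) \<partial>std_gauss_pair r) =
    (\<integral>z. (\<Sum>j<dim_vec a. a $ j * (hermite_basis 1 j (snd z) * hermite_basis 1 k (fst z))) \<partial>std_gauss_pair r)"
    by (simp add: hermite_payoff_def sum_distrib_right mult.assoc)
  also have "\<dots> = (\<Sum>j<dim_vec a. a $ j * (if j = k then r ^ k else 0))"
    by (simp add: Bochner_Integration.integral_sum integrable_hermite_std_gauss_pair
        integral_hermite_basis_cross_std_gauss_pair[OF assms(1)])
  also have "\<dots> = a $ k * r ^ k"
    using assms(2) by (simp add: if_distrib cong: if_cong)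
  finally show ?thesis .
qed

lemma integral_hermite_basis_squares_std_gauss_pair:
  assumes "r\<^sup>2 \<le> 1"
  shows "(\<integral>z. (hermite_basis 1 j (snd z) * hermite_basis 1 k (fst z))\<^sup>2 \<partial>std_gauss_pair r) =
    (\<Sum>i\<le>k. real (k choose i) * real (j choose i) * real (2 * i choose i) * r ^ (2 * i))"
proof -
  have "(\<integral>z. (hermite_basis 1 j (snd z) * hermite_basis 1 k (fst z))\<^sup>2 \<partial>std_gauss_pair r) =
    (\<integral>z. 1 / (fact k * fact j) * (poly ((hermite_poly k)\<^sup>2) (fst z) * poly ((hermite_poly j)\<^sup>2) (snd z)) \<partial>std_gauss_pair r)"
    by (simp add: hermite_basis_eq_poly power_mult_distrib power_divide mult.commute)
  then show ?thesis
    by (simp only: integral_mult_right_zero integral_hermite_poly_squares_std_gauss_pair[OF assms]) simp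
qed

section \<open>Exponential bounds for the binomial sums and second moments\<close>

lemma power_double: "x ^ (2 * n) = x ^ n * (x ^ n :: real)"
  by (simp only: mult_2 power_add)

text \<open>Since \<open>2 * i choose i\<close> is at most \<open>4 ^ i\<close>, each summand is at
  most the square of the binomial term \<open>c i\<close> of \<open>(1 + 2 * r) ^ K\<close>. A sum
  of squares of nonnegative numbers is at most the square of their sum.\<close>

lemma sum_choose_central_le:
  fixes r :: real
  assumes "0 \<le> r" "j \<le> K" "k \<le> K"
  shows "(\<Sum>i\<le>k. real (k choose i) * real (j choose i) * real (2 * i choose i) * r ^ (2 * i)) \<le> (1 + 2 * r) ^ (2 * K)"
proof -
  define c where "c i = real (K choose i) * (2 * r) ^ i" for i
  have c: "0 \<le> c i" for i using assms(1) by (simp add: c_def)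
  have sum_c: "(\<Sum>i\<le>K. c i) = (1 + 2 * r) ^ K"
    using binomial_ring[of "2 * r" 1 K] by (simp add: c_def add.commute)
  have "real (k choose i) * real (j choose i) * real (2 * i choose i) * r ^ (2 * i) \<le> c i * c i" for i
  proof -
    have "real (k choose i) \<le> real (K choose i)" "real (j choose i) \<le> real (K choose i)"
      using assms by (simp_all add: binomial_right_mono)
    moreover have "real (2 * i choose i) \<le> 2 ^ (2 * i)"
    proof -
      have "real (2 * i choose i) \<le> real (2 ^ (2 * i))"
        by (simp only: of_nat_le_iff binomial_le_pow2)
      then show ?thesis by simp
    qed
    ultimately have "real (k choose i) * real (j choose i) * real (2 * i choose i) * r ^ (2 * i)
      \<le> real (K choose i) * real (K choose i) * 2 ^ (2 * i) * r ^ (2 * i)"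
      using assms(1) by (intro mult_mono) auto
    also have "\<dots> = c i * c i"
      by (simp add: c_def power_mult_distrib power_double)
    finally show ?thesis .
  qed
  then have "(\<Sum>i\<le>k. real (k choose i) * real (j choose i) * real (2 * i choose i) * r ^ (2 * i)) \<le> (\<Sum>i\<le>k. c i * c i)"
    by (intro sum_mono)
  also have "\<dots> \<le> (\<Sum>i\<le>K. c i * c i)"
    using assms(3) c by (intro sum_mono2) auto
  also have "\<dots> \<le> (\<Sum>i\<le>K. c i * (\<Sum>j\<le>K. c j))"
    using c by (intro sum_mono mult_left_mono member_le_sum) auto
  also have "\<dots> = (1 + 2 * r) ^ (2 * K)"
    by (simp add: sum_distrib_right[symmetric] sum_c power_double)
  finally show ?thesis .
qed

text \<open>The converse estimate up to polynomial factors: Cauchy-Schwarz over \<open>K + 1\<close>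
  terms costs \<open>K + 1\<close>, and replacing \<open>4 ^ i\<close> by the central binomial costs
  \<open>2 * K + 1\<close>.\<close>

lemma sum_choose_central_ge:
  fixes r :: real
  assumes "0 \<le> r"
  shows "(1 + 2 * r) ^ (2 * K) / ((2 * real K + 1) * (real K + 1))
    \<le> (\<Sum>i\<le>K. real (K choose i) * real (K choose i) * real (2 * i choose i) * r ^ (2 * i))"
proof -
  define c where "c i = real (K choose i) * (2 * r) ^ i" for i
  have sum_c: "(\<Sum>i\<le>K. c i) = (1 + 2 * r) ^ K"
    using binomial_ring[of "2 * r" 1 K] by (simp add: c_def add.commute)
  have "(1 + 2 * r) ^ (2 * K) = (\<Sum>i\<le>K. c i)\<^sup>2"
    by (simp only: sum_c power_double power2_eq_square)
  also have "\<dots> = (\<Sum>i\<le>K. c i * 1)\<^sup>2" by simp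
  also have "\<dots> \<le> (\<Sum>i\<le>K. (c i)\<^sup>2) * (\<Sum>i\<le>K. 1\<^sup>2)"
    by (rule Cauchy_Schwarz_ineq_sum)
  also have "\<dots> \<le> ((2 * real K + 1) *
      (\<Sum>i\<le>K. real (K choose i) * real (K choose i) * real (2 * i choose i) * r ^ (2 * i))) * (real K + 1)"
  proof -
    have "(c i)\<^sup>2 \<le> (2 * real K + 1) * (real (K choose i) * real (K choose i) * real (2 * i choose i) * r ^ (2 * i))"
      if "i \<le> K" for i
    proof -
      have "(4 :: real) ^ i \<le> (2 * real i + 1) * real (2 * i choose i)"
      \<comment> \<open>The available lower bound for the central binomial divides by
        \<open>2 * i\<close>, hence the separate case.\<close>
      proof (cases "i = 0")
        case False
        then have "(4 :: real) ^ i / (2 * real i) \<le> real (2 * i choose i)"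
          using central_binomial_lower_bound[of i] by simp
        then have "(4 :: real) ^ i \<le> 2 * real i * real (2 * i choose i)"
          using False by (simp add: field_simps)
        then show ?thesis by (simp add: algebra_simps add_increasing)
      qed simp
      also have "\<dots> \<le> (2 * real K + 1) * real (2 * i choose i)"
        using that by (intro mult_right_mono) auto
      finally have "(real (K choose i))\<^sup>2 * r ^ (2 * i) * 4 ^ i
          \<le> (real (K choose i))\<^sup>2 * r ^ (2 * i) * ((2 * real K + 1) * real (2 * i choose i))"
        using assms by (intro mult_left_mono) auto
      moreover have "(c i)\<^sup>2 = (real (K choose i))\<^sup>2 * r ^ (2 * i) * 4 ^ i"
      proof -
        have "(4 :: real) ^ i = 2 ^ i * 2 ^ i" by (simp flip: power_mult_distrib)
        then show ?thesis by (simp add: c_def power_mult_distrib power2_eq_square power_double)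
      qed
      ultimately show ?thesis by (simp only: power2_eq_square mult_ac)
    qed
    then have "(\<Sum>i\<le>K. (c i)\<^sup>2) \<le> (2 * real K + 1) *
      (\<Sum>i\<le>K. real (K choose i) * real (K choose i) * real (2 * i choose i) * r ^ (2 * i))"
      unfolding sum_distrib_left by (intro sum_mono) simp
    then show ?thesis by (simp add: mult_right_mono add.commute)
  qed
  finally have "(1 + 2 * r) ^ (2 * K) \<le>
      (\<Sum>i\<le>K. real (K choose i) * real (K choose i) * real (2 * i choose i) * r ^ (2 * i))
      * ((2 * real K + 1) * (real K + 1))"
    by (simp only: mult_ac)
  moreover have "0 < (2 * real K + 1) * (real K + 1)" by simp
  ultimately show ?thesis by (simp only: pos_divide_le_eq)
qed

text \<open>Pairing \<open>a $ j * r ^ j\<close>, the components of the unit vector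
  \<open>\<beta>\<close>, with the basis divided by \<open>r ^ j\<close> makes Cauchy-Schwarz
  uniform in \<open>a\<close>. The factor \<open>K + 1\<close> counts the indices
  \<open>j\<close>.\<close>

lemma hermite_second_moment_le:
  assumes r: "0 < r" "r \<le> 1" and a: "dim_vec a = K + 1" "(\<Sum>j\<le>K. (a $ j * r ^ j)\<^sup>2) = 1" and k: "k \<le> K"
  shows "(\<integral>z. (hermite_payoff 1 a (snd z) * hermite_basis 1 k (fst z))\<^sup>2 \<partial>std_gauss_pair r)
    \<le> (real K + 1) * ((1 + 2 * r) / r) ^ (2 * K)"
proof -
  have r2: "r\<^sup>2 \<le> 1" using r by (simp add: power_le_one)
  have "(\<integral>z. (hermite_payoff 1 a (snd z) * hermite_basis 1 k (fst z))\<^sup>2 \<partial>std_gauss_pair r) \<le>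
    (\<integral>z. (\<Sum>j\<le>K. (1 / r ^ (2 * K)) * (hermite_basis 1 j (snd z) * hermite_basis 1 k (fst z))\<^sup>2) \<partial>std_gauss_pair r)"
  proof (rule integral_mono)
    fix z :: "real \<times> real"
    have "(hermite_payoff 1 a (snd z))\<^sup>2 = (\<Sum>j\<le>K. (a $ j * r ^ j) * (hermite_basis 1 j (snd z) / r ^ j))\<^sup>2"
      using r by (simp add: hermite_payoff_def a lessThan_Suc_atMost)
    also have "\<dots> \<le> (\<Sum>j\<le>K. (a $ j * r ^ j)\<^sup>2) * (\<Sum>j\<le>K. (hermite_basis 1 j (snd z) / r ^ j)\<^sup>2)"
      by (rule Cauchy_Schwarz_ineq_sum)
    also have "\<dots> = (\<Sum>j\<le>K. (hermite_basis 1 j (snd z))\<^sup>2 / r ^ (2 * j))"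
      by (simp add: a power_divide power_mult[symmetric] mult.commute)
    also have "\<dots> \<le> (\<Sum>j\<le>K. (hermite_basis 1 j (snd z))\<^sup>2 / r ^ (2 * K))"
      using r by (intro sum_mono divide_left_mono power_decreasing) auto
    finally have "(hermite_payoff 1 a (snd z))\<^sup>2 * (hermite_basis 1 k (fst z))\<^sup>2
      \<le> (\<Sum>j\<le>K. (hermite_basis 1 j (snd z))\<^sup>2 / r ^ (2 * K)) * (hermite_basis 1 k (fst z))\<^sup>2"
      by (rule mult_right_mono) simp
    then show "(hermite_payoff 1 a (snd z) * hermite_basis 1 k (fst z))\<^sup>2 \<le>
      (\<Sum>j\<le>K. (1 / r ^ (2 * K)) * (hermite_basis 1 j (snd z) * hermite_basis 1 k (fst z))\<^sup>2)"
      by (simp add: power_mult_distrib sum_distrib_right)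
  qed (intro Bochner_Integration.integrable_sum integrable_mult_right integrable_hermite_std_gauss_pair)+
  also have "\<dots> = (\<Sum>j\<le>K. (1 / r ^ (2 * K)) *
      (\<integral>z. (hermite_basis 1 j (snd z) * hermite_basis 1 k (fst z))\<^sup>2 \<partial>std_gauss_pair r))"
    by (simp add: Bochner_Integration.integral_sum integrable_hermite_std_gauss_pair)
  also have "\<dots> \<le> (\<Sum>j\<le>K. (1 / r ^ (2 * K)) * (1 + 2 * r) ^ (2 * K))"
    unfolding integral_hermite_basis_squares_std_gauss_pair[OF r2]
    using r k by (intro sum_mono mult_left_mono sum_choose_central_le) auto
  also have "\<dots> = (real K + 1) * ((1 + 2 * r) / r) ^ (2 * K)"
    by (simp add: power_divide add.commute)
  finally show ?thesis .
qed

lemma hermite_second_moment_ge: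
  assumes r: "0 < r" "r \<le> 1"
  shows "((1 + 2 * r) / r) ^ (2 * K) / ((2 * real K + 1) * (real K + 1)) \<le>
    (\<integral>z. (hermite_basis 1 K (snd z) / r ^ K * hermite_basis 1 K (fst z))\<^sup>2 \<partial>std_gauss_pair r)"
proof -
  have r2: "r\<^sup>2 \<le> 1" using r by (simp add: power_le_one)
  have "((1 + 2 * r) / r) ^ (2 * K) / ((2 * real K + 1) * (real K + 1)) =
      1 / r ^ (2 * K) * ((1 + 2 * r) ^ (2 * K) / ((2 * real K + 1) * (real K + 1)))"
    by (simp add: power_divide)
  also have "\<dots> \<le> 1 / r ^ (2 * K) *
      (\<integral>z. (hermite_basis 1 K (snd z) * hermite_basis 1 K (fst z))\<^sup>2 \<partial>std_gauss_pair r)"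
    unfolding integral_hermite_basis_squares_std_gauss_pair[OF r2]
    using r by (intro mult_left_mono sum_choose_central_ge) auto
  also have "\<dots> = (\<integral>z. 1 / r ^ (2 * K) * (hermite_basis 1 K (snd z) * hermite_basis 1 K (fst z))\<^sup>2 \<partial>std_gauss_pair r)"
    by (rule integral_mult_right_zero[symmetric])
  also have "\<dots> = (\<integral>z. (hermite_basis 1 K (snd z) / r ^ K * hermite_basis 1 K (fst z))\<^sup>2 \<partial>std_gauss_pair r)"
    by (intro Bochner_Integration.integral_cong refl)
      (simp add: power_mult_distrib power_divide power_mult[symmetric] mult.commute)
  finally show ?thesis .
qed

subsection \<open>Regression estimators\<close>

text \<open>The squared error is a double sum of products of centred variables; independence kills
  the off-diagonal terms, and the \<open>N\<close> diagonal ones each contribute the variance over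
  \<open>N^2\<close>.\<close>

lemma independent_copies_sample_mean_variance:
  fixes g :: "'c \<Rightarrow> real"
  assumes M: "prob_space M" and copies: "independent_copies M L X N Q Z" and "1 \<le> N"
    and X [measurable]: "X \<in> M \<rightarrow>\<^sub>M L" and g [measurable]: "g \<in> borel_measurable L"
    and sq: "integrable M (\<lambda>\<omega>. (g (X \<omega>))\<^sup>2)"
  shows "integrable Q (\<lambda>\<omega>. ((\<Sum>i=1..N. g (Z i \<omega>)) / real N - (\<integral>\<omega>. g (X \<omega>) \<partial>M))\<^sup>2)" (is ?int)
    and "(\<integral>\<omega>. ((\<Sum>i=1..N. g (Z i \<omega>)) / real N - (\<integral>\<omega>. g (X \<omega>) \<partial>M))\<^sup>2 \<partial>Q) =
      ((\<integral>\<omega>. (g (X \<omega>))\<^sup>2 \<partial>M) - (\<integral>\<omega>. g (X \<omega>) \<partial>M)\<^sup>2) / real N" (is ?eq)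
proof -
  interpret M: prob_space M by (rule M)
  interpret Q: prob_space Q using copies by (simp add: independent_copies_def)
  define m where "m = (\<integral>\<omega>. g (X \<omega>) \<partial>M)"
  define W where "W i \<omega> = g (Z i \<omega>) - m" for i \<omega>
  define v where "v = (\<integral>\<omega>. (g (X \<omega>))\<^sup>2 \<partial>M) - m\<^sup>2"
  have ind: "Q.indep_vars (\<lambda>_. L) Z {1..N}"
    using copies by (simp add: independent_copies_def)
  have law: "distr Q L (Z i) = distr M L X" if "i \<in> {1..N}" for i
    using copies that by (simp add: independent_copies_def)
  have Z: "Z i \<in> Q \<rightarrow>\<^sub>M L" if "i \<in> {1..N}" for i
    using ind that unfolding Q.indep_vars_def by blast
  have transfer: "integrable Q (\<lambda>\<omega>. f (Z i \<omega>)) \<longleftrightarrow> integrable M (\<lambda>\<omega>. f (X \<omega>))"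
    "(\<integral>\<omega>. f (Z i \<omega>) \<partial>Q) = (\<integral>\<omega>. f (X \<omega>) \<partial>M)"
    \<comment> \<open>Equality of the laws under \<open>L\<close> transports integrability and
      integrals of every measurable \<open>f\<close> from \<open>Z i\<close> to
      \<open>X\<close>.\<close>
    if i: "i \<in> {1..N}" and f: "f \<in> borel_measurable L" for i and f :: "'c \<Rightarrow> real"
    unfolding integrable_distr_eq[OF Z[OF i] f, symmetric] integrable_distr_eq[OF X f, symmetric]
      integral_distr[OF Z[OF i] f, symmetric] integral_distr[OF X f, symmetric] law[OF i] by (rule refl)+
  have int: "integrable M (\<lambda>\<omega>. g (X \<omega>))"
    by (rule M.square_integrable_imp_integrable[OF _ sq]) simp
  have int_sq: "integrable M (\<lambda>\<omega>. (g (X \<omega>) - m)\<^sup>2)"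
    using int sq by (simp add: power2_diff)
  have W: "integrable Q (W i)" "integrable Q (\<lambda>\<omega>. (W i \<omega>)\<^sup>2)" "(\<integral>\<omega>. W i \<omega> \<partial>Q) = 0"
    "(\<integral>\<omega>. (W i \<omega>)\<^sup>2 \<partial>Q) = v" if i: "i \<in> {1..N}" for i
  proof -
    show "integrable Q (W i)" "integrable Q (\<lambda>\<omega>. (W i \<omega>)\<^sup>2)"
      unfolding W_def[abs_def]
      using transfer(1)[OF i, of "\<lambda>x. g x - m"] transfer(1)[OF i, of "\<lambda>x. (g x - m)\<^sup>2"] int int_sq
      by simp_all
    show "(\<integral>\<omega>. W i \<omega> \<partial>Q) = 0"
      using transfer(2)[OF i, of "\<lambda>x. g x - m"] int by (simp add: W_def m_def M.prob_space)
    show "(\<integral>\<omega>. (W i \<omega>)\<^sup>2 \<partial>Q) = v"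
      using transfer(2)[OF i, of "\<lambda>x. (g x - m)\<^sup>2"] M.variance_eq[OF int sq]
      by (simp add: W_def v_def m_def)
  qed
  have indW: "Q.indep_vars (\<lambda>_. borel) W {1..N}"
    using Q.indep_vars_compose2[OF ind, of "\<lambda>_ z. g z - m" "\<lambda>_. borel"] by (simp add: W_def[abs_def])
  have WW: "integrable Q (\<lambda>\<omega>. W i \<omega> * W j \<omega>)"
    "(\<integral>\<omega>. W i \<omega> * W j \<omega> \<partial>Q) = (if i = j then v else 0)" if ij: "i \<in> {1..N}" "j \<in> {1..N}" for i j
  proof -
    have "integrable Q (\<lambda>\<omega>. W i \<omega> * W j \<omega>) \<and> (\<integral>\<omega>. W i \<omega> * W j \<omega> \<partial>Q) = (if i = j then v else 0)"
    proof (cases "i = j")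
      case True
      then show ?thesis using W[OF ij(1)] by (simp add: power2_eq_square)
    next
      case False
      have ind_ij: "Q.indep_vars (\<lambda>_. borel) W {i, j}"
        by (rule Q.indep_vars_subset[OF indW]) (use ij in auto)
      have ind_int: "integrable Q (W k)" if "k \<in> {i, j}" for k
        using that W(1) ij by blast
      have pair: "(\<Prod>k\<in>{i, j}. f k) = f i * f j" for f :: "nat \<Rightarrow> real"
        using False by simp
      have "(\<integral>\<omega>. W i \<omega> * W j \<omega> \<partial>Q) = (\<integral>\<omega>. W i \<omega> \<partial>Q) * (\<integral>\<omega>. W j \<omega> \<partial>Q)"
        using Q.indep_vars_lebesgue_integral[OF _ ind_ij ind_int] unfolding pair by simp
      moreover have "integrable Q (\<lambda>\<omega>. W i \<omega> * W j \<omega>)"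
        using Q.indep_vars_integrable[OF _ ind_ij ind_int] unfolding pair by simp
      ultimately show ?thesis
        using False W(3)[OF ij(1)] by simp
    qed
    then show "integrable Q (\<lambda>\<omega>. W i \<omega> * W j \<omega>)"
      "(\<integral>\<omega>. W i \<omega> * W j \<omega> \<partial>Q) = (if i = j then v else 0)" by auto
  qed
  have eq: "((\<Sum>i=1..N. g (Z i \<omega>)) / real N - m)\<^sup>2 = (\<Sum>i=1..N. \<Sum>j=1..N. W i \<omega> * W j \<omega>) / (real N)\<^sup>2" for \<omega>
  proof -
    \<comment> \<open>Here \<open>N >= 1\<close> matters: the mean \<open>m\<close> is distributed
      over the \<open>N\<close> summands.\<close>
    have "(\<Sum>i=1..N. g (Z i \<omega>)) / real N - m = (\<Sum>i=1..N. W i \<omega>) / real N"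
      using \<open>1 \<le> N\<close> by (simp add: W_def sum_subtractf diff_divide_distrib)
    then show ?thesis by (simp add: power_divide sum_product power2_eq_square)
  qed
  show ?int
    unfolding m_def[symmetric] eq
    by (intro integrable_divide_zero Bochner_Integration.integrable_sum WW)
  have "(\<integral>\<omega>. ((\<Sum>i=1..N. g (Z i \<omega>)) / real N - m)\<^sup>2 \<partial>Q) =
     (\<Sum>i=1..N. \<Sum>j=1..N. if i = j then v else 0) / (real N)\<^sup>2"
  proof -
    have "(\<integral>\<omega>. (\<Sum>i=1..N. \<Sum>j=1..N. W i \<omega> * W j \<omega>) \<partial>Q) = (\<Sum>i=1..N. \<integral>\<omega>. (\<Sum>j=1..N. W i \<omega> * W j \<omega>) \<partial>Q)"
      by (intro Bochner_Integration.integral_sum Bochner_Integration.integrable_sum WW)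
    also have "\<dots> = (\<Sum>i=1..N. \<Sum>j=1..N. \<integral>\<omega>. W i \<omega> * W j \<omega> \<partial>Q)"
      by (intro sum.cong refl Bochner_Integration.integral_sum WW)
    also have "\<dots> = (\<Sum>i=1..N. \<Sum>j=1..N. if i = j then v else 0)"
      by (intro sum.cong refl WW)
    finally show ?thesis unfolding eq by simp
  qed
  also have "\<dots> = v / real N"
    using \<open>1 \<le> N\<close> by (simp add: power2_eq_square)
  finally show ?eq by (simp add: m_def v_def)
qed

text \<open>\<open>mat_inverse\<close> has an optional result. \<open>None\<close> is impossible
  since the identity is a unit of the matrix ring, and a returned \<open>B\<close> satisfies
  \<open>1 * B = 1\<close>.\<close>

lemma mat_inverse_one: "mat_inverse (1\<^sub>m n) = Some (1\<^sub>m n :: real mat)"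
proof (cases "mat_inverse (1\<^sub>m n :: real mat)")
  case None
  have "(1\<^sub>m n :: real mat) \<in> Units (ring_mat TYPE(real) n ())"
    by (auto simp: Units_def ring_mat_def intro!: bexI[of _ "1\<^sub>m n"])
  then show ?thesis
    using mat_inverse(1)[OF one_carrier_mat None, where b = "()"] by blast
next
  case (Some B)
  then have "1\<^sub>m n * B = 1\<^sub>m n" "B \<in> carrier_mat n n"
    using mat_inverse(2)[OF one_carrier_mat Some] by auto
  then show ?thesis using Some by simp
qed

lemma vec_norm2_power2: "(vec_norm2 v)\<^sup>2 = (\<Sum>i<dim_vec v. (v $ i)\<^sup>2)"
  by (simp add: vec_norm2_def L2_set_def sum_nonneg)

lemma regression_coeffs_orthonormal:
  assumes "gram_mat M \<psi> K X = 1\<^sub>m (K + 1)"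
  shows "regression_coeffs M \<psi> K X Y = cross_vec M \<psi> K X Y"
  unfolding regression_coeffs_def assms mat_inverse_one option.sel
  by (rule one_mult_mat_vec) (simp add: cross_vec_def)

lemma regression_est_orthonormal:
  assumes "gram_mat M \<psi> K X = 1\<^sub>m (K + 1)"
  shows "regression_est M \<psi> K X N Z \<omega> = cross_vec_est \<psi> K N Z \<omega>"
  unfolding regression_est_def assms mat_inverse_one option.sel
  by (rule one_mult_mat_vec) (simp add: cross_vec_est_def)

text \<open>With the identity as Gram matrix the error vector consists of the errors of
  \<open>K + 1\<close> sample means, so the mean square error is the sum of their variances; no
  covariances between components enter.\<close>

lemma regression_mse_orthonormal:
  assumes M: "prob_space M" and gram: "gram_mat M \<psi> K X = 1\<^sub>m (K + 1)"
    and copies: "independent_copies M borel (\<lambda>\<omega>. (X \<omega>, Y \<omega>)) N Q Z" and N: "1 \<le> N"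
    and [measurable]: "X \<in> borel_measurable M" "Y \<in> borel_measurable M"
    and \<psi> [measurable]: "\<And>k. \<psi> k \<in> borel_measurable borel"
    and sq: "\<And>k. k \<le> K \<Longrightarrow> integrable M (\<lambda>\<omega>. (Y \<omega> * \<psi> k (X \<omega>))\<^sup>2)"
  shows "regression_mse M \<psi> K X Y N Q Z =
    ennreal ((\<Sum>k\<le>K. (\<integral>\<omega>. (Y \<omega> * \<psi> k (X \<omega>))\<^sup>2 \<partial>M) - (\<integral>\<omega>. Y \<omega> * \<psi> k (X \<omega>) \<partial>M)\<^sup>2) / real N)"
proof -
  define err where "err k \<omega> = ((\<Sum>i=1..N. snd (Z i \<omega>) * \<psi> k (fst (Z i \<omega>))) / real N
    - (\<integral>\<omega>. Y \<omega> * \<psi> k (X \<omega>) \<partial>M))\<^sup>2" for k \<omega>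
  have "(vec_norm2 (regression_est M \<psi> K X N Z \<omega> - regression_coeffs M \<psi> K X Y))\<^sup>2 = (\<Sum>k\<le>K. err k \<omega>)" for \<omega>
    unfolding regression_coeffs_orthonormal[OF gram] regression_est_orthonormal[OF gram] vec_norm2_power2
    by (simp add: cross_vec_def cross_vec_est_def err_def lessThan_Suc_atMost)
  then have mse: "regression_mse M \<psi> K X Y N Q Z = (\<integral>\<^sup>+ \<omega>. ennreal (\<Sum>k\<le>K. err k \<omega>) \<partial>Q)"
    by (simp add: regression_mse_def)
  have pair: "(\<lambda>\<omega>. (X \<omega>, Y \<omega>)) \<in> M \<rightarrow>\<^sub>M borel"
    unfolding borel_prod[symmetric] by measurable
  have g: "(\<lambda>z. snd z * \<psi> k (fst z)) \<in> borel_measurable borel" for k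
    unfolding borel_prod[symmetric] by measurable
  have err: "integrable Q (err k)"
    "(\<integral>\<omega>. err k \<omega> \<partial>Q) = ((\<integral>\<omega>. (Y \<omega> * \<psi> k (X \<omega>))\<^sup>2 \<partial>M) - (\<integral>\<omega>. Y \<omega> * \<psi> k (X \<omega>) \<partial>M)\<^sup>2) / real N"
    if "k \<le> K" for k
    using independent_copies_sample_mean_variance[OF M copies N pair g, of k] sq[OF that]
    by (simp_all add: err_def[abs_def])
  have "(\<integral>\<^sup>+ \<omega>. ennreal (\<Sum>k\<le>K. err k \<omega>) \<partial>Q) = ennreal (\<integral>\<omega>. (\<Sum>k\<le>K. err k \<omega>) \<partial>Q)"
    by (intro nn_integral_eq_integral Bochner_Integration.integrable_sum err)
      (auto simp: err_def intro!: sum_nonneg)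
  also have "(\<integral>\<omega>. (\<Sum>k\<le>K. err k \<omega>) \<partial>Q) = (\<Sum>k\<le>K. \<integral>\<omega>. err k \<omega> \<partial>Q)"
    by (intro Bochner_Integration.integral_sum err) simp
  finally show ?thesis
    unfolding mse by (simp add: err(2) sum_divide_distrib)
qed

subsection \<open>Hermite regression for Brownian motion\<close>

text \<open>The normalised increments over \<open>[0, t1]\<close> and \<open>[t1, t2]\<close> are
  independent standard normals. The normalised value at \<open>t2\<close> combines them with weights
  \<open>sqrt (t1 / t2)\<close> and \<open>sqrt (1 - t1 / t2)\<close>.\<close>

lemma standard_brownian_motion_distr_pair:
  assumes S: "standard_brownian_motion M S" and t: "0 < t1" "t1 < t2"
  shows "distr M borel (\<lambda>\<omega>. (S t1 \<omega> / sqrt t1, S t2 \<omega> / sqrt t2)) = std_gauss_pair (sqrt (t1 / t2))"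
proof -
  interpret prob_space M using S by (simp add: standard_brownian_motion_def)
  have [measurable]: "S t1 \<in> borel_measurable M" "S t2 \<in> borel_measurable M" "S 0 \<in> borel_measurable M"
    using S t by (simp_all add: standard_brownian_motion_def)
  have start: "AE \<omega> in M. S 0 \<omega> = 0"
    using S by (simp add: standard_brownian_motion_def)
  have incr: "distr M borel (\<lambda>\<omega>. (S t \<omega> - S s \<omega>) / sqrt (t - s)) = std_gauss"
    if "0 \<le> s" "s < t" for s t
  proof -
    have "distributed M lborel (\<lambda>\<omega>. S t \<omega> - S s \<omega>) (normal_density 0 (sqrt (t - s)))"
      using S that by (simp add: standard_brownian_motion_def)
    then have "distributed M lborel (\<lambda>\<omega>. (S t \<omega> - S s \<omega>) / sqrt (t - s)) std_normal_density"
      using that normal_standard_normal_convert[of "sqrt (t - s)" "\<lambda>\<omega>. S t \<omega> - S s \<omega>" 0] by simp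
    then have "distr M lborel (\<lambda>\<omega>. (S t \<omega> - S s \<omega>) / sqrt (t - s)) = std_gauss"
      unfolding std_gauss_def by (rule distributed_distr_eq_density)
    then show ?thesis by (simp cong: distr_cong)
  qed
  \<comment> \<open>The grid 0, \<open>t1\<close>, \<open>t2\<close> gives two increments; later
    values of the sequence do not matter for \<open>n = 2\<close>.\<close>
  define \<tau> where "\<tau> i = (if i = 0 then 0 else if i = 1 then t1 else t2)" for i :: nat
  have "0 \<le> \<tau> 0 \<and> (\<forall>i<2. \<tau> i < \<tau> (Suc i))"
    using t by (auto simp: \<tau>_def less_Suc_eq numeral_2_eq_2)
  then have ind: "indep_vars (\<lambda>_. borel) (\<lambda>i \<omega>. S (\<tau> (Suc i)) \<omega> - S (\<tau> i) \<omega>) {..<2}"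
    using S unfolding standard_brownian_motion_def by blast
  have "indep_var borel (\<lambda>\<omega>. S t1 \<omega> - S 0 \<omega>) borel (\<lambda>\<omega>. S t2 \<omega> - S t1 \<omega>)"
  proof -
    let ?X = "\<lambda>i \<omega>. S (\<tau> (Suc i)) \<omega> - S (\<tau> i) \<omega>"
    \<comment> \<open>The family over \<open>{..<2}\<close> is split into the singleton blocks 0 and
      1, from which the coordinates are then projected out.\<close>
    have "indep_var (PiM {0} (\<lambda>_. borel)) (\<lambda>\<omega>. restrict (\<lambda>i. ?X i \<omega>) {0})
        (PiM {1} (\<lambda>_. borel)) (\<lambda>\<omega>. restrict (\<lambda>i. ?X i \<omega>) {1})"
      by (rule indep_var_restrict[OF ind]) auto
    then have "indep_var borel ((\<lambda>f. f 0) \<circ> (\<lambda>\<omega>. restrict (\<lambda>i. ?X i \<omega>) {0}))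
        borel ((\<lambda>f. f 1) \<circ> (\<lambda>\<omega>. restrict (\<lambda>i. ?X i \<omega>) {1}))"
      by (rule indep_var_compose) (auto intro: measurable_component_singleton)
    then show ?thesis by (simp add: o_def \<tau>_def)
  qed
  then have "indep_var borel ((\<lambda>x. x / sqrt t1) \<circ> (\<lambda>\<omega>. S t1 \<omega> - S 0 \<omega>))
      borel ((\<lambda>x. x / sqrt (t2 - t1)) \<circ> (\<lambda>\<omega>. S t2 \<omega> - S t1 \<omega>))"
    by (rule indep_var_compose) simp_all
  then have "distr M (borel \<Otimes>\<^sub>M borel) (\<lambda>\<omega>. ((S t1 \<omega> - S 0 \<omega>) / sqrt t1, (S t2 \<omega> - S t1 \<omega>) / sqrt (t2 - t1)))
      = std_gauss \<Otimes>\<^sub>M std_gauss" (is "distr M _ ?G = _")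
    using incr[of 0 t1] incr[of t1 t2] t by (simp add: indep_var_distribution_eq o_def)
  then have "std_gauss_pair (sqrt (t1 / t2)) = distr (distr M (borel \<Otimes>\<^sub>M borel) ?G) borel
      (\<lambda>z. (fst z, sqrt (t1 / t2) * fst z + sqrt (1 - (sqrt (t1 / t2))\<^sup>2) * snd z))"
    by (simp add: std_gauss_pair_def)
  also have "\<dots> = distr M borel ((\<lambda>z. (fst z, sqrt (t1 / t2) * fst z + sqrt (1 - (sqrt (t1 / t2))\<^sup>2) * snd z)) \<circ> ?G)"
    by (rule distr_distr) (simp_all add: borel_prod[symmetric])
  also have "\<dots> = distr M borel (\<lambda>\<omega>. (S t1 \<omega> / sqrt t1, S t2 \<omega> / sqrt t2))"
  \<comment> \<open>\<open>S 0 = 0\<close> holds only almost surely, so the two random vectors agree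
    only almost everywhere.\<close>
  proof (rule distr_cong_AE)
    have scale: "sqrt (t1 / t2) * (x / sqrt t1) + sqrt (1 - (sqrt (t1 / t2))\<^sup>2) * ((y - x) / sqrt (t2 - t1))
      = y / sqrt t2" for x y
    proof -
      have "1 - (sqrt (t1 / t2))\<^sup>2 = (t2 - t1) / t2" using t by (simp add: field_simps)
      then have "sqrt (1 - (sqrt (t1 / t2))\<^sup>2) = sqrt (t2 - t1) / sqrt t2"
        by (simp only: real_sqrt_divide)
      then show ?thesis
        unfolding real_sqrt_divide[of t1] using t by (simp add: field_simps)
    qed
    show "AE \<omega> in M. ((\<lambda>z. (fst z, sqrt (t1 / t2) * fst z + sqrt (1 - (sqrt (t1 / t2))\<^sup>2) * snd z)) \<circ> ?G) \<omega>
        = (S t1 \<omega> / sqrt t1, S t2 \<omega> / sqrt t2)"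
      using start by eventually_elim (simp only: o_def fst_conv snd_conv diff_zero scale)
  qed (simp_all add: borel_prod[symmetric])
  finally show ?thesis ..
qed

lemma borel_measurable_hermite_basis [measurable]: "hermite_basis t k \<in> borel_measurable borel"
  unfolding hermite_basis_def[abs_def] hermite_e_eq_poly by measurable

lemma borel_measurable_hermite_payoff [measurable]: "hermite_payoff t a \<in> borel_measurable borel"
  unfolding hermite_payoff_def[abs_def] by measurable

context
  fixes M :: "'a measure" and S :: "real \<Rightarrow> 'a \<Rightarrow> real" and t1 t2 r :: real
  assumes t: "0 < t1" "t1 < t2"
    and S: "standard_brownian_motion M S"
  defines "r \<equiv> sqrt (t1 / t2)"
begin

lemma correlation_bounds: "0 < r" "r \<le> 1" "r\<^sup>2 \<le> 1"
  using t by (simp_all add: r_def)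

lemma brownian_measurable: "S t1 \<in> borel_measurable M" "S t2 \<in> borel_measurable M"
  using S t by (simp_all add: standard_brownian_motion_def)

lemma brownian_transfer:
  fixes f :: "real \<times> real \<Rightarrow> real"
  assumes "f \<in> borel_measurable (borel \<Otimes>\<^sub>M borel)"
  shows "(\<integral>\<omega>. f (S t1 \<omega> / sqrt t1, S t2 \<omega> / sqrt t2) \<partial>M) = (\<integral>z. f z \<partial>std_gauss_pair r)"
    and "integrable M (\<lambda>\<omega>. f (S t1 \<omega> / sqrt t1, S t2 \<omega> / sqrt t2)) \<longleftrightarrow> integrable (std_gauss_pair r) f"
proof -
  note [measurable] = brownian_measurable
  have f: "f \<in> borel_measurable borel"
    using assms by (simp add: borel_prod)
  have X: "(\<lambda>\<omega>. (S t1 \<omega> / sqrt t1, S t2 \<omega> / sqrt t2)) \<in> M \<rightarrow>\<^sub>M borel"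
    unfolding borel_prod[symmetric] by measurable
  show "(\<integral>\<omega>. f (S t1 \<omega> / sqrt t1, S t2 \<omega> / sqrt t2) \<partial>M) = (\<integral>z. f z \<partial>std_gauss_pair r)"
    "integrable M (\<lambda>\<omega>. f (S t1 \<omega> / sqrt t1, S t2 \<omega> / sqrt t2)) \<longleftrightarrow> integrable (std_gauss_pair r) f"
    unfolding r_def standard_brownian_motion_distr_pair[OF S t, symmetric]
    by (simp_all add: integral_distr[OF X f] integrable_distr_eq[OF X f])
qed

lemma gram_mat_hermite: "gram_mat M (hermite_basis t1) K (S t1) = 1\<^sub>m (K + 1)"
proof -
  have "(\<integral>\<omega>. hermite_basis t1 i (S t1 \<omega>) * hermite_basis t1 j (S t1 \<omega>) \<partial>M) = (if i = j then 1 else 0)" for i j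
    using brownian_transfer(1)[of "\<lambda>z. hermite_basis 1 i (fst z) * hermite_basis 1 j (fst z)"]
    by (simp add: hermite_basis_scale[of t1] integral_hermite_basis_std_gauss_pair)
  then show ?thesis by (intro eq_matI) (simp_all add: gram_mat_def)
qed

lemma integral_hermite_payoff_brownian:
  "(\<integral>\<omega>. hermite_payoff t2 a (S t2 \<omega>) * hermite_basis t1 k (S t1 \<omega>) \<partial>M) =
    (\<integral>z. hermite_payoff 1 a (snd z) * hermite_basis 1 k (fst z) \<partial>std_gauss_pair r)"
  "(\<integral>\<omega>. (hermite_payoff t2 a (S t2 \<omega>) * hermite_basis t1 k (S t1 \<omega>))\<^sup>2 \<partial>M) =
    (\<integral>z. (hermite_payoff 1 a (snd z) * hermite_basis 1 k (fst z))\<^sup>2 \<partial>std_gauss_pair r)"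
  "integrable M (\<lambda>\<omega>. (hermite_payoff t2 a (S t2 \<omega>) * hermite_basis t1 k (S t1 \<omega>))\<^sup>2)"
  using brownian_transfer(1)[of "\<lambda>z. hermite_payoff 1 a (snd z) * hermite_basis 1 k (fst z)"]
    brownian_transfer[of "\<lambda>z. (hermite_payoff 1 a (snd z) * hermite_basis 1 k (fst z))\<^sup>2"]
  by (simp_all add: hermite_basis_scale[of t1] hermite_payoff_scale[of t2] integrable_hermite_std_gauss_pair)

lemma regression_coeffs_hermite:
  assumes "a \<in> carrier_vec (K + 1)"
  shows "regression_coeffs M (hermite_basis t1) K (S t1) (\<lambda>\<omega>. hermite_payoff t2 a (S t2 \<omega>))
    = vec (K + 1) (\<lambda>k. a $ k * r ^ k)"
  unfolding regression_coeffs_orthonormal[OF gram_mat_hermite]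
  using assms
  by (intro eq_vecI)
    (simp_all add: cross_vec_def integral_hermite_payoff_brownian
      integral_hermite_payoff_std_gauss_pair correlation_bounds)

lemma vec_norm2_regression_coeffs_hermite:
  assumes "a \<in> carrier_vec (K + 1)"
  shows "vec_norm2 (regression_coeffs M (hermite_basis t1) K (S t1) (\<lambda>\<omega>. hermite_payoff t2 a (S t2 \<omega>))) = 1
    \<longleftrightarrow> (\<Sum>k\<le>K. (a $ k * r ^ k)\<^sup>2) = 1"
  unfolding regression_coeffs_hermite[OF assms] vec_norm2_def L2_set_def
  by (simp add: lessThan_Suc_atMost)

lemma regression_mse_hermite:
  assumes a: "a \<in> carrier_vec (K + 1)" and N: "1 \<le> N"
    and copies: "independent_copies M borel (\<lambda>\<omega>. (S t1 \<omega>, hermite_payoff t2 a (S t2 \<omega>))) N Q Z"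
  shows "regression_mse M (hermite_basis t1) K (S t1) (\<lambda>\<omega>. hermite_payoff t2 a (S t2 \<omega>)) N Q Z =
    ennreal (((\<Sum>k\<le>K. \<integral>z. (hermite_payoff 1 a (snd z) * hermite_basis 1 k (fst z))\<^sup>2 \<partial>std_gauss_pair r)
      - (\<Sum>k\<le>K. (a $ k * r ^ k)\<^sup>2)) / real N)"
proof -
  have M: "prob_space M" using S by (simp add: standard_brownian_motion_def)
  note [measurable] = brownian_measurable
  show ?thesis
    using a
    by (subst regression_mse_orthonormal[OF M gram_mat_hermite copies N])
      (simp_all add: integral_hermite_payoff_brownian sum_subtractf
        integral_hermite_payoff_std_gauss_pair correlation_bounds)
qed

text \<open>The base of the exponential growth; twice its logarithm is the constant \<open>c\<close>
  of the theorem.\<close>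

lemma growth_rate: "(1 + 2 * r) / r = 2 + sqrt (t2 / t1)"
proof -
  have "1 / r = sqrt (t2 / t1)" using t by (simp add: r_def real_sqrt_divide)
  then show ?thesis using correlation_bounds(1) by (simp add: add_divide_distrib)
qed

text \<open>The sum over \<open>k\<close> contributes a second factor \<open>K + 1\<close>, and the
  subtracted square norm is dropped.\<close>

lemma regression_mse_hermite_le:
  assumes a: "a \<in> carrier_vec (K + 1)" "(\<Sum>k\<le>K. (a $ k * r ^ k)\<^sup>2) = 1" and N: "1 \<le> N"
    and copies: "independent_copies M borel (\<lambda>\<omega>. (S t1 \<omega>, hermite_payoff t2 a (S t2 \<omega>))) N Q Z"
  shows "regression_mse M (hermite_basis t1) K (S t1) (\<lambda>\<omega>. hermite_payoff t2 a (S t2 \<omega>)) N Q Z \<le>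
    ennreal ((real K + 1)\<^sup>2 * (2 + sqrt (t2 / t1)) ^ (2 * K) / real N)"
proof -
  have "(\<Sum>k\<le>K. \<integral>z. (hermite_payoff 1 a (snd z) * hermite_basis 1 k (fst z))\<^sup>2 \<partial>std_gauss_pair r)
    \<le> (\<Sum>k\<le>K. (real K + 1) * (2 + sqrt (t2 / t1)) ^ (2 * K))"
    unfolding growth_rate[symmetric] using a correlation_bounds
    by (intro sum_mono hermite_second_moment_le) auto
  also have "\<dots> = (real K + 1)\<^sup>2 * (2 + sqrt (t2 / t1)) ^ (2 * K)"
    by (simp add: power2_eq_square add.commute)
  finally show ?thesis
    unfolding regression_mse_hermite[OF a(1) N copies] a(2)
    by (intro ennreal_leI divide_right_mono) auto
qed

text \<open>The witness \<open>a\<close> loads only the highest order, scaled by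
  \<open>1 / r ^ K\<close> so that \<open>\<beta>\<close> is the last unit vector. Of the second
  moments only \<open>k = K\<close> is kept; the \<open>- 1\<close> is the square norm of
  \<open>\<beta>\<close>.\<close>

lemma regression_mse_hermite_ge:
  fixes K :: nat
  defines "a \<equiv> (1 / r ^ K) \<cdot>\<^sub>v unit_vec (K + 1) K"
  assumes N: "1 \<le> N"
    and copies: "independent_copies M borel (\<lambda>\<omega>. (S t1 \<omega>, hermite_payoff t2 a (S t2 \<omega>))) N Q Z"
  shows "(\<Sum>k\<le>K. (a $ k * r ^ k)\<^sup>2) = 1"
    and "regression_mse M (hermite_basis t1) K (S t1) (\<lambda>\<omega>. hermite_payoff t2 a (S t2 \<omega>)) N Q Z \<ge>
      ennreal (((2 + sqrt (t2 / t1)) ^ (2 * K) / ((2 * real K + 1) * (real K + 1)) - 1) / real N)"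
proof -
  have a: "a \<in> carrier_vec (K + 1)" by (simp add: a_def)
  have a_nth: "a $ k = (if k = K then 1 / r ^ K else 0)" if "k \<le> K" for k
    using that by (simp add: a_def unit_vec_def)
  have "(\<Sum>k\<le>K. (a $ k * r ^ k)\<^sup>2) = (\<Sum>k\<le>K. if k = K then 1 else 0)"
    using correlation_bounds(1) by (intro sum.cong refl) (simp add: a_nth)
  then show norm: "(\<Sum>k\<le>K. (a $ k * r ^ k)\<^sup>2) = 1" by simp
  have payoff: "hermite_payoff 1 a u = hermite_basis 1 K u / r ^ K" for u
  proof -
    have "hermite_payoff 1 a u = (\<Sum>k\<le>K. a $ k * hermite_basis 1 k u)"
      using a by (simp add: hermite_payoff_def lessThan_Suc_atMost)
    also have "\<dots> = (\<Sum>k\<le>K. if k = K then hermite_basis 1 K u / r ^ K else 0)"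
      by (intro sum.cong refl) (simp add: a_nth)
    finally show ?thesis by simp
  qed
  have "(2 + sqrt (t2 / t1)) ^ (2 * K) / ((2 * real K + 1) * (real K + 1))
    \<le> (\<integral>z. (hermite_payoff 1 a (snd z) * hermite_basis 1 K (fst z))\<^sup>2 \<partial>std_gauss_pair r)"
    unfolding growth_rate[symmetric] payoff using correlation_bounds by (intro hermite_second_moment_ge)
  also have "\<dots> \<le> (\<Sum>k\<le>K. \<integral>z. (hermite_payoff 1 a (snd z) * hermite_basis 1 k (fst z))\<^sup>2 \<partial>std_gauss_pair r)"
    by (rule member_le_sum) auto
  finally show "regression_mse M (hermite_basis t1) K (S t1) (\<lambda>\<omega>. hermite_payoff t2 a (S t2 \<omega>)) N Q Z \<ge>
      ennreal (((2 + sqrt (t2 / t1)) ^ (2 * K) / ((2 * real K + 1) * (real K + 1)) - 1) / real N)"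
    unfolding regression_mse_hermite[OF a N copies] norm
    by (intro ennreal_leI divide_right_mono) auto
qed

end

subsection \<open>Critical growth rate\<close>

text \<open>As \<open>b ^ (2 * K N) = exp (c * K N)\<close> is at most
  \<open>N powr (1 - \<delta>)\<close>, the quotient is at most a power of the logarithm times
  \<open>N powr (- \<delta>)\<close>.\<close>

lemma subcritical_growth_tendsto_0:
  fixes b c \<delta> :: real
  assumes b: "1 < b" and c: "c = 2 * ln b" and \<delta>: "0 < \<delta>" "\<delta> < 1"
  defines "K \<equiv> \<lambda>N. nat \<lfloor>(1 - \<delta>) * ln (real N) / c\<rfloor>"
  shows "(\<lambda>N. (real (K N) + 1)\<^sup>2 * b ^ (2 * K N) / real N) \<longlonglongrightarrow> 0"
proof (rule tendsto_sandwich[where f = "\<lambda>_. 0"])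
  have c_pos: "0 < c" using b c by simp
  show "(\<lambda>N. ((1 - \<delta>) * ln (real N) / c + 1)\<^sup>2 * real N powr (1 - \<delta>) / real N) \<longlonglongrightarrow> 0"
    using c_pos \<delta> by real_asymp
  show "\<forall>\<^sub>F N in sequentially. (real (K N) + 1)\<^sup>2 * b ^ (2 * K N) / real N \<le>
    ((1 - \<delta>) * ln (real N) / c + 1)\<^sup>2 * real N powr (1 - \<delta>) / real N"
    using eventually_ge_at_top[of 1]
  proof eventually_elim
    case (elim N)
    \<comment> \<open>For \<open>N >= 1\<close> the logarithm is nonnegative, so \<open>nat\<close>
      cuts nothing off.\<close>
    have K: "real (K N) \<le> (1 - \<delta>) * ln (real N) / c"
      unfolding K_def using elim \<delta> c_pos by (intro of_nat_floor) simp
    have "b ^ (2 * K N) = exp (c * real (K N))"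
      using b by (simp add: c exp_of_nat_mult[symmetric] powr_realpow[symmetric] powr_def mult_ac)
    also have "\<dots> \<le> exp ((1 - \<delta>) * ln (real N))"
      using K c_pos by (simp add: field_simps)
    also have "\<dots> = real N powr (1 - \<delta>)"
      using elim by (simp add: powr_def)
    finally show ?case
      using K by (intro divide_right_mono mult_mono power_mono) auto
  qed
  show "\<forall>\<^sub>F N in sequentially. 0 \<le> (real (K N) + 1)\<^sup>2 * b ^ (2 * K N) / real N"
    using b by simp
qed simp

lemma supercritical_growth_at_top:
  fixes b c \<delta> :: real
  assumes b: "1 < b" and c: "c = 2 * ln b" and \<delta>: "0 < \<delta>"
  defines "K \<equiv> \<lambda>N. nat \<lfloor>(1 + \<delta>) * ln (real N) / c\<rfloor>"
  shows "filterlim (\<lambda>N. (b ^ (2 * K N) / ((2 * real (K N) + 1) * (real (K N) + 1)) - 1) / real N) at_top sequentially"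
proof (rule filterlim_at_top_mono)
  define L where "L N = (1 + \<delta>) * ln (real N) / c" for N
  have c_pos: "0 < c" using b c by simp
  show "filterlim (\<lambda>N. (real N powr (1 + \<delta>) * exp (- c) / ((2 * ((1 + \<delta>) * ln (real N) / c) + 1)
      * ((1 + \<delta>) * ln (real N) / c + 1)) - 1) / real N) at_top sequentially"
    using c_pos \<delta> by real_asymp
  show "\<forall>\<^sub>F N in sequentially. (real N powr (1 + \<delta>) * exp (- c) / ((2 * ((1 + \<delta>) * ln (real N) / c) + 1)
      * ((1 + \<delta>) * ln (real N) / c + 1)) - 1) / real N
      \<le> (b ^ (2 * K N) / ((2 * real (K N) + 1) * (real (K N) + 1)) - 1) / real N"
    using eventually_ge_at_top[of 1]
  proof eventually_elim
    case (elim N)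
    have K: "real (K N) \<le> L N"
      unfolding K_def L_def using elim \<delta> c_pos by (intro of_nat_floor) simp
    \<comment> \<open>The floor loses at most one, which is where the factor
      \<open>exp (- c)\<close> in the minorant comes from.\<close>
    have "L N \<le> real (K N) + 1"
      unfolding K_def L_def by linarith
    then have "(1 + \<delta>) * ln (real N) - c \<le> c * real (K N)"
      using c_pos by (simp add: L_def field_simps)
    then have "exp ((1 + \<delta>) * ln (real N) - c) \<le> exp (c * real (K N))" by simp
    moreover have "exp ((1 + \<delta>) * ln (real N) - c) = real N powr (1 + \<delta>) * exp (- c)"
      using elim by (simp add: powr_def exp_diff exp_minus field_simps)
    moreover have "exp (c * real (K N)) = b ^ (2 * K N)"
      using b by (simp add: c exp_of_nat_mult[symmetric] powr_realpow[symmetric] powr_def mult_ac)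
    ultimately have "real N powr (1 + \<delta>) * exp (- c) \<le> b ^ (2 * K N)" by simp
    \<comment> \<open>The numerator uses the lower bound on \<open>K N\<close>, the denominator the
      upper bound by \<open>L N\<close>.\<close>
    then have "real N powr (1 + \<delta>) * exp (- c) / ((2 * L N + 1) * (L N + 1))
      \<le> b ^ (2 * K N) / ((2 * real (K N) + 1) * (real (K N) + 1))"
      using K b by (intro frac_le mult_mono) auto
    then show ?case
      unfolding L_def by (intro divide_right_mono diff_right_mono) auto
  qed
qed

theorem theorem1:
  fixes M :: "'a measure" and S :: "real \<Rightarrow> 'a \<Rightarrow> real"
    and t1 t2 \<rho> c :: real
    and Y :: "real vec \<Rightarrow> 'a \<Rightarrow> real"
    and Q :: "nat \<Rightarrow> real vec \<Rightarrow> 'b measure"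
    and Z :: "nat \<Rightarrow> real vec \<Rightarrow> nat \<Rightarrow> 'b \<Rightarrow> real \<times> real"
    and worst_mse :: "nat \<Rightarrow> nat \<Rightarrow> ennreal"
  assumes "0 < t1" and "t1 < t2"
    and "standard_brownian_motion M S"
  defines "\<rho> \<equiv> t2 / t1"
    and "c \<equiv> 2 * ln (2 + sqrt \<rho>)"
    and "Y \<equiv> \<lambda>a \<omega>. hermite_payoff t2 a (S t2 \<omega>)"
  assumes copies: "\<And>N K a. 1 \<le> N \<Longrightarrow> a \<in> carrier_vec (K + 1) \<Longrightarrow>
      independent_copies M borel (\<lambda>\<omega>. (S t1 \<omega>, Y a \<omega>)) N (Q N a) (Z N a)"
  defines "worst_mse \<equiv> \<lambda>K N.
      (SUP a \<in> {a \<in> carrier_vec (K + 1).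
                 vec_norm2 (regression_coeffs M (hermite_basis t1) K (S t1) (Y a)) = 1}.
         regression_mse M (hermite_basis t1) K (S t1) (Y a) N (Q N a) (Z N a))"
  shows "(\<forall>\<delta>. 0 < \<delta> \<and> \<delta> < 1 \<longrightarrow>
            (\<lambda>N. worst_mse (nat \<lfloor>(1 - \<delta>) * ln (real N) / c\<rfloor>) N) \<longlonglongrightarrow> 0) \<and>
         (\<forall>\<delta>>0. (\<lambda>N. worst_mse (nat \<lfloor>(1 + \<delta>) * ln (real N) / c\<rfloor>) N) \<longlonglongrightarrow> \<infinity>)"
proof -
  define K1 where "K1 \<delta> N = nat \<lfloor>(1 - \<delta>) * ln (real N) / c\<rfloor>" for \<delta> and N :: nat
  define K2 where "K2 \<delta> N = nat \<lfloor>(1 + \<delta>) * ln (real N) / c\<rfloor>" for \<delta> and N :: nat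
  have b: "1 < 2 + sqrt \<rho>"
    using assms(1,2) by (simp add: \<rho>_def add_pos_nonneg)
  have upper: "worst_mse K N \<le> ennreal ((real K + 1)\<^sup>2 * (2 + sqrt \<rho>) ^ (2 * K) / real N)"
    if N: "1 \<le> N" for K N
    unfolding worst_mse_def Y_def \<rho>_def
  proof (rule SUP_least)
    fix a assume "a \<in> {a \<in> carrier_vec (K + 1). vec_norm2
      (regression_coeffs M (hermite_basis t1) K (S t1) (\<lambda>\<omega>. hermite_payoff t2 a (S t2 \<omega>))) = 1}"
    then have a: "a \<in> carrier_vec (K + 1)" "(\<Sum>k\<le>K. (a $ k * sqrt (t1 / t2) ^ k)\<^sup>2) = 1"
      using vec_norm2_regression_coeffs_hermite[OF assms(1-3)] by auto
    show "regression_mse M (hermite_basis t1) K (S t1) (\<lambda>\<omega>. hermite_payoff t2 a (S t2 \<omega>)) N (Q N a) (Z N a)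
      \<le> ennreal ((real K + 1)\<^sup>2 * (2 + sqrt (t2 / t1)) ^ (2 * K) / real N)"
      by (rule regression_mse_hermite_le[OF assms(1-3) a N copies[OF N a(1), unfolded Y_def]])
  qed
  have lower: "ennreal (((2 + sqrt \<rho>) ^ (2 * K) / ((2 * real K + 1) * (real K + 1)) - 1) / real N) \<le> worst_mse K N"
    if N: "1 \<le> N" for K N
  proof -
    \<comment> \<open>The extremal payoff of \<open>regression_mse_hermite_ge\<close>, with
      \<open>r\<close> written out as \<open>sqrt (t1 / t2)\<close>.\<close>
    let ?a = "(1 / sqrt (t1 / t2) ^ K) \<cdot>\<^sub>v unit_vec (K + 1) K :: real vec"
    have a: "?a \<in> carrier_vec (K + 1)" by simp
    note ge = regression_mse_hermite_ge[OF assms(1-3) N copies[OF N a, unfolded Y_def]]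
    show ?thesis
      unfolding worst_mse_def Y_def \<rho>_def
      by (rule order_trans[OF ge(2)], rule SUP_upper)
        (use a ge(1) vec_norm2_regression_coeffs_hermite[OF assms(1-3) a] in auto)
  qed
  have "(\<lambda>N. worst_mse (K1 \<delta> N) N) \<longlonglongrightarrow> 0" if \<delta>: "0 < \<delta>" "\<delta> < 1" for \<delta>
  proof (rule tendsto_sandwich[where f = "\<lambda>_. 0"])
    show "(\<lambda>N. ennreal ((real (K1 \<delta> N) + 1)\<^sup>2 * (2 + sqrt \<rho>) ^ (2 * K1 \<delta> N) / real N)) \<longlonglongrightarrow> 0"
      unfolding K1_def ennreal_0[symmetric]
      by (intro tendsto_ennrealI subcritical_growth_tendsto_0 b \<delta> c_def[THEN meta_eq_to_obj_eq])
    show "\<forall>\<^sub>F N in sequentially. worst_mse (K1 \<delta> N) N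
        \<le> ennreal ((real (K1 \<delta> N) + 1)\<^sup>2 * (2 + sqrt \<rho>) ^ (2 * K1 \<delta> N) / real N)"
      \<comment> \<open>The copies are given only for \<open>N >= 1\<close>, so the bound holds
        eventually.\<close>
      using eventually_ge_at_top[of 1] by eventually_elim (rule upper)
  qed simp_all
  moreover have "(\<lambda>N. worst_mse (K2 \<delta> N) N) \<longlonglongrightarrow> \<infinity>" if \<delta>: "0 < \<delta>" for \<delta>
  proof (rule tendsto_sandwich[where h = "\<lambda>_. \<infinity>"])
    show "(\<lambda>N. ennreal (((2 + sqrt \<rho>) ^ (2 * K2 \<delta> N) / ((2 * real (K2 \<delta> N) + 1) * (real (K2 \<delta> N) + 1)) - 1)
        / real N)) \<longlonglongrightarrow> \<infinity>"
      unfolding K2_def infinity_ennreal_def ennreal_tendsto_top_eq_at_top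
      by (intro supercritical_growth_at_top b \<delta> c_def[THEN meta_eq_to_obj_eq])
    show "\<forall>\<^sub>F N in sequentially. ennreal (((2 + sqrt \<rho>) ^ (2 * K2 \<delta> N) / ((2 * real (K2 \<delta> N) + 1)
        * (real (K2 \<delta> N) + 1)) - 1) / real N) \<le> worst_mse (K2 \<delta> N) N"
      using eventually_ge_at_top[of 1] by eventually_elim (rule lower)
  qed (simp_all add: infinity_ennreal_def)
  ultimately show ?thesis
    unfolding K1_def K2_def by blast
qed

end
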